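(* Let $R$ be a finitely generated $\mathbb{Z}_{\geq 0}$-semiring. Assume that all two-sided cells in $R$ are idempotent. Then every minimal proper $R$-semimodule is isomorphic to a quotient of a reduced cell semimodule $\tilde{C}_{\mathcal{L}}$, for some left cell $\mathcal{L}$ of $R$. Conversely, every non-zero quotient of a reduced cell semimodule is minimal.
   Context: A semiring is a tuple $(R,+,\cdot,0,1)$ where $(R,+,0)$ is a commutative monoid, $(R,\cdot,1)$ is a monoid, multiplication distributes over addition on both sides, and $0a=a0=0$ for all $a\in R$. A (left) $R$-semimodule is a commutative monoid $(M,+,0_M)$ with a map $R\times M\to M$, $(r,m)\mapsto r(m)$, such that $r(m+n)=r(m)+r(n)$, $r(0_M)=0_M$, $(r+s)(m)=r(m)+s(m)$, $(rs)(m)=r(s(m))$, $0(m)=0_M$, $1(m)=m$. It is called an $R$-module if $M$ is an abelian group, and a proper semimodule if it is not a module. A subsemimodule is a submonoid closed under the action of $R$. An $R$-congruence on $M$ is an equivalence relation $\sim$ such that $m\sim n$ implies $m+k\sim n+k$ for all $k\in M$ and $r(m)\sim r(n)$ for all $r\in R$; a quotient of $M$ is an $R$-semimodule $M/\sim$ for such $\sim$. A non-zero $R$-semimodule $M$ is called minimal if its only subsemimodules are $\{0_M\}$ and $M$. A finitely generated $\mathbb{Z}_{\geq 0}$-semiring is a semiring $R$ containing a finite $\mathbb{Z}_{\geq 0}$-basis $\mathbf{r}=\{r_1,\dots,r_k\}$, i.e. every element of $R$ can be written uniquely as a linear combination of elements of $\mathbf{r}$ with coefficients in $\mathbb{Z}_{\geq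 0}$ (such a basis is unique). Cells. For $r_i,r_j\in\mathbf{r}$ write $r_i\leq_L r_j$ if there is $r\in R$ such that the coefficient of $r_j$ in $rr_i$ is non-zero; this is a pre-order, and its equivalence classes (on $\mathbf{r}$) are the left cells. The right pre-order $\leq_R$ and right cells are defined similarly using $r_ir$, and the two-sided pre-order $\leq_J$ and two-sided cells using $rr_ir'$ with $r,r'\in R$. An $\mathcal{H}$-cell is the intersection of a left cell and a right cell. A two-sided cell is idempotent if it contains (not necessarily distinct) elements $x,y,z$ such that $xy$ has a non-zero coefficient at $z$. Reduced cell semimodules (all two-sided cells assumed idempotent). For a left cell $\mathcal{L}$, let $\mathcal{H}_i$, $i\in I$, be the complete list of non-empty $\mathcal{H}$-cells contained in $\mathcal{L}$. Let $\tilde{C}_{\mathcal{L}}:=2^I$ be the set of all subsets of $I$, a commutative monoid under union (Boolean addition) with zero $\varnothing$. For $r_j\in\mathbf{r}$ and $i\in I$, let $r_j\cdot i\subseteq I$ be the set of all $s\in I$ for which there exist $x\in\mathcal{H}_i$ and $y\in\mathcal{H}_s$ such that $y$ appears with a non-zero coefficient in $r_jx$. Extended additively (in both arguments), this makes $\tilde{C}_{\mathcal{L}}$ an $R$-semimodule, called the reduced cell semimodule corresponding to $\mathcal{L}$. *)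

theory Defs
  imports "HOL-Algebra.Module"
begin

section \<open>Semimodules over a semiring\<close>

text \<open>Semimodules use the \<^type>\<open>module\<close> record of HOL-Algebra. Its fields \<^const>\<open>mult\<close> and
  \<^const>\<open>one\<close> play no role.\<close>

locale semimodule = R?: semiring R + M?: abelian_monoid M for R (structure) and M (structure) +
  assumes smult_closed:
      "\<lbrakk>a \<in> carrier R; x \<in> carrier M\<rbrakk> \<Longrightarrow> a \<odot>\<^bsub>M\<^esub> x \<in> carrier M"
    and smult_r_distr:
      "\<lbrakk>a \<in> carrier R; x \<in> carrier M; y \<in> carrier M\<rbrakk> \<Longrightarrow>
        a \<odot>\<^bsub>M\<^esub> (x \<oplus>\<^bsub>M\<^esub> y) = a \<odot>\<^bsub>M\<^esub> x \<oplus>\<^bsub>M\<^esub> a \<odot>\<^bsub>M\<^esub> y"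
    and smult_zero:
      "a \<in> carrier R \<Longrightarrow> a \<odot>\<^bsub>M\<^esub> \<zero>\<^bsub>M\<^esub> = \<zero>\<^bsub>M\<^esub>"
    and smult_l_distr:
      "\<lbrakk>a \<in> carrier R; b \<in> carrier R; x \<in> carrier M\<rbrakk> \<Longrightarrow>
        (a \<oplus>\<^bsub>R\<^esub> b) \<odot>\<^bsub>M\<^esub> x = a \<odot>\<^bsub>M\<^esub> x \<oplus>\<^bsub>M\<^esub> b \<odot>\<^bsub>M\<^esub> x"
    and smult_assoc:
      "\<lbrakk>a \<in> carrier R; b \<in> carrier R; x \<in> carrier M\<rbrakk> \<Longrightarrow>
        (a \<otimes>\<^bsub>R\<^esub> b) \<odot>\<^bsub>M\<^esub> x = a \<odot>\<^bsub>M\<^esub> (b \<odot>\<^bsub>M\<^esub> x)"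
    and zero_smult:
      "x \<in> carrier M \<Longrightarrow> \<zero>\<^bsub>R\<^esub> \<odot>\<^bsub>M\<^esub> x = \<zero>\<^bsub>M\<^esub>"
    and one_smult:
      "x \<in> carrier M \<Longrightarrow> \<one>\<^bsub>R\<^esub> \<odot>\<^bsub>M\<^esub> x = x"

definition proper_semimodule ::
    "('r, 'x) ring_scheme \<Rightarrow> ('r, 'm, 'y) module_scheme \<Rightarrow> bool" where
  "proper_semimodule R M \<longleftrightarrow> semimodule R M \<and> \<not> abelian_group M"

definition subsemimodule ::
    "'m set \<Rightarrow> ('r, 'x) ring_scheme \<Rightarrow> ('r, 'm, 'y) module_scheme \<Rightarrow> bool" where
  "subsemimodule N R M \<longleftrightarrow>
     submonoid N (add_monoid M) \<and> (\<forall>a\<in>carrier R. \<forall>x\<in>N. a \<odot>\<^bsub>M\<^esub> x \<in> N)"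

definition minimal_semimodule ::
    "('r, 'x) ring_scheme \<Rightarrow> ('r, 'm, 'y) module_scheme \<Rightarrow> bool" where
  "minimal_semimodule R M \<longleftrightarrow>
     semimodule R M \<and> carrier M \<noteq> {\<zero>\<^bsub>M\<^esub>} \<and>
     (\<forall>N. subsemimodule N R M \<longrightarrow> N = {\<zero>\<^bsub>M\<^esub>} \<or> N = carrier M)"

definition semimodule_congruence ::
    "('r, 'x) ring_scheme \<Rightarrow> ('r, 'm, 'y) module_scheme \<Rightarrow> ('m \<times> 'm) set \<Rightarrow> bool" where
  "semimodule_congruence R M E \<longleftrightarrow>
     equiv (carrier M) E \<and>
     (\<forall>(x, y)\<in>E. \<forall>z\<in>carrier M. (x \<oplus>\<^bsub>M\<^esub> z, y \<oplus>\<^bsub>M\<^esub> z) \<in> E) \<and>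
     (\<forall>(x, y)\<in>E. \<forall>a\<in>carrier R. (a \<odot>\<^bsub>M\<^esub> x, a \<odot>\<^bsub>M\<^esub> y) \<in> E)"

definition quotient_semimodule ::
    "('r, 'm, 'y) module_scheme \<Rightarrow> ('m \<times> 'm) set \<Rightarrow> ('r, 'm set) module" where
  "quotient_semimodule M E =
     \<lparr>carrier = carrier M // E, mult = undefined, one = undefined,
      zero = E `` {\<zero>\<^bsub>M\<^esub>},
      add = (\<lambda>X Y. \<Union>x\<in>X. \<Union>y\<in>Y. E `` {x \<oplus>\<^bsub>M\<^esub> y}),
      smult = (\<lambda>a X. \<Union>x\<in>X. E `` {a \<odot>\<^bsub>M\<^esub> x})\<rparr>"

definition semimodule_isomorphic ::
    "('r, 'x) ring_scheme \<Rightarrow> ('r, 'm, 'y) module_scheme \<Rightarrow> ('r, 'n, 'z) module_scheme \<Rightarrow> bool"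
  where
  "semimodule_isomorphic R M N \<longleftrightarrow>
     (\<exists>f. bij_betw f (carrier M) (carrier N) \<and> f \<zero>\<^bsub>M\<^esub> = \<zero>\<^bsub>N\<^esub> \<and>
        (\<forall>x\<in>carrier M. \<forall>y\<in>carrier M. f (x \<oplus>\<^bsub>M\<^esub> y) = f x \<oplus>\<^bsub>N\<^esub> f y) \<and>
        (\<forall>a\<in>carrier R. \<forall>x\<in>carrier M. f (a \<odot>\<^bsub>M\<^esub> x) = a \<odot>\<^bsub>N\<^esub> f x))"


section \<open>Semirings with a finite basis over the non-negative integers\<close>

text \<open>Coefficient families are extensional, so that uniqueness of the linear combination is
  uniqueness of a function.\<close>

definition lin_comb :: "('r, 'x) ring_scheme \<Rightarrow> 'r set \<Rightarrow> ('r \<Rightarrow> nat) \<Rightarrow> 'r" where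
  "lin_comb R B c = (\<Oplus>\<^bsub>R\<^esub>b\<in>B. [c b] \<cdot>\<^bsub>R\<^esub> b)"

locale fg_nat_semiring = semiring R for R (structure) +
  fixes B :: "'a set"
  assumes finite_basis: "finite B"
    and basis_closed: "B \<subseteq> carrier R"
    and unique_lin_comb:
      "a \<in> carrier R \<Longrightarrow> \<exists>!c. c \<in> B \<rightarrow>\<^sub>E (UNIV :: nat set) \<and> a = lin_comb R B c"

definition basis_coeff :: "('r, 'x) ring_scheme \<Rightarrow> 'r set \<Rightarrow> 'r \<Rightarrow> 'r \<Rightarrow> nat" where
  "basis_coeff R B a = (THE c. c \<in> B \<rightarrow>\<^sub>E (UNIV :: nat set) \<and> a = lin_comb R B c)"


section \<open>Cells\<close>

definition left_preorder :: "('r, 'x) ring_scheme \<Rightarrow> 'r set \<Rightarrow> 'r rel" where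
  "left_preorder R B =
     {(x, y) \<in> B \<times> B. \<exists>a\<in>carrier R. basis_coeff R B (a \<otimes>\<^bsub>R\<^esub> x) y \<noteq> 0}"

definition right_preorder :: "('r, 'x) ring_scheme \<Rightarrow> 'r set \<Rightarrow> 'r rel" where
  "right_preorder R B =
     {(x, y) \<in> B \<times> B. \<exists>a\<in>carrier R. basis_coeff R B (x \<otimes>\<^bsub>R\<^esub> a) y \<noteq> 0}"

definition two_sided_preorder :: "('r, 'x) ring_scheme \<Rightarrow> 'r set \<Rightarrow> 'r rel" where
  "two_sided_preorder R B =
     {(x, y) \<in> B \<times> B. \<exists>a\<in>carrier R. \<exists>a'\<in>carrier R.
        basis_coeff R B (a \<otimes>\<^bsub>R\<^esub> x \<otimes>\<^bsub>R\<^esub> a') y \<noteq> 0}"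

definition left_cells :: "('r, 'x) ring_scheme \<Rightarrow> 'r set \<Rightarrow> 'r set set" where
  "left_cells R B = B // (left_preorder R B \<inter> (left_preorder R B)\<inverse>)"

definition right_cells :: "('r, 'x) ring_scheme \<Rightarrow> 'r set \<Rightarrow> 'r set set" where
  "right_cells R B = B // (right_preorder R B \<inter> (right_preorder R B)\<inverse>)"

definition two_sided_cells :: "('r, 'x) ring_scheme \<Rightarrow> 'r set \<Rightarrow> 'r set set" where
  "two_sided_cells R B = B // (two_sided_preorder R B \<inter> (two_sided_preorder R B)\<inverse>)"

definition H_cells :: "('r, 'x) ring_scheme \<Rightarrow> 'r set \<Rightarrow> 'r set set" where
  "H_cells R B = {K \<inter> K' | K K'. K \<in> left_cells R B \<and> K' \<in> right_cells R B}"

definition idempotent_cell :: "('r, 'x) ring_scheme \<Rightarrow> 'r set \<Rightarrow> 'r set \<Rightarrow> bool" where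
  "idempotent_cell R B J \<longleftrightarrow>
     (\<exists>x\<in>J. \<exists>y\<in>J. \<exists>z\<in>J. basis_coeff R B (x \<otimes>\<^bsub>R\<^esub> y) z \<noteq> 0)"


section \<open>Reduced cell semimodules\<close>

text \<open>The non-empty H-cells inside the left cell \<open>L\<close> serve as their own indices.\<close>

definition H_cells_in :: "('r, 'x) ring_scheme \<Rightarrow> 'r set \<Rightarrow> 'r set \<Rightarrow> 'r set set" where
  "H_cells_in R B L = {H \<in> H_cells R B. H \<noteq> {} \<and> H \<subseteq> L}"

definition H_action ::
    "('r, 'x) ring_scheme \<Rightarrow> 'r set \<Rightarrow> 'r set \<Rightarrow> 'r \<Rightarrow> 'r set \<Rightarrow> 'r set set" where
  "H_action R B L b H =
     {K \<in> H_cells_in R B L. \<exists>x\<in>H. \<exists>y\<in>K. basis_coeff R B (b \<otimes>\<^bsub>R\<^esub> x) y \<noteq> 0}"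

text \<open>Addition is idempotent, so a positive multiple of a basis element acts like the basis
  element itself: the additive extension only sees which coefficients are non-zero.\<close>

definition reduced_cell_semimodule ::
    "('r, 'x) ring_scheme \<Rightarrow> 'r set \<Rightarrow> 'r set \<Rightarrow> ('r, 'r set set) module" where
  "reduced_cell_semimodule R B L =
     \<lparr>carrier = Pow (H_cells_in R B L), mult = undefined, one = undefined,
      zero = {}, add = (\<union>),
      smult = (\<lambda>a X. \<Union>b\<in>{b \<in> B. basis_coeff R B a b \<noteq> 0}. \<Union>H\<in>X. H_action R B L b H)\<rparr>"

end

theory Submission
  imports Defs
begin

text \<open>
  Call the basis elements with non-zero coefficient the support of an element. Coefficients are
  non-negative, so nothing cancels and the support of a product is the union of the supports of the
  products of basis elements.

  Both halves rest on stability of the cells: if \<open>x \<preceq>\<^sub>L y\<close> and \<open>x\<close>, \<open>y\<close> lie in the same two-sided cell,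
  then they lie in the same left cell, and likewise on the right. Supports alone do not give this:
  with \<open>x * 1 = {1, 2}\<close> and \<open>x * 2 = {2}\<close> for \<open>x\<close> in \<open>{1, 2}\<close> one has an associative multivalued
  product with a single two-sided cell, in which 2 lies strictly above 1 for the left preorder. What
  excludes it is counting. Let \<open>f\<close> be the sum of the basis. On a two-sided cell, left and right
  multiplication by \<open>f\<close> are commuting non-negative integer matrices whose product has only positive
  entries. A Perron-Frobenius eigenvector of the product is shared by the factors, and a
  non-negative matrix with positive left and right eigenvectors cannot have an arrow from one strong
  component to another. The lemma \<open>closed_imp_backward_closed\<close> proves this without eigenvectors, by
  comparing numbers of walks.

  Stability makes the action on H-cells independent of representatives
  (\<open>H_class_action_independent\<close>), so that the reduced cell semimodule is a semimodule. Idempotency of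
  the two-sided cell supplies, for every H-cell \<open>K\<close> of \<open>L\<close> and every non-empty set \<open>X\<close> of H-cells, a
  basis element in the right cell of \<open>K\<close> that sends \<open>X\<close> to exactly \<open>{K}\<close>. Hence the reduced cell
  semimodule is minimal, and minimality passes to non-zero quotients.

  Conversely let \<open>M\<close> be minimal and proper. Various subsets of \<open>M\<close> are subsemimodules and therefore
  trivial. Applied to the invertible elements, this shows that \<open>M\<close> has no non-trivial inverses;
  applied to the doubles, that every element is a double. As \<open>M\<close> is finitely generated, some
  non-zero element is then idempotent, so all are, and \<open>M\<close> is a finite join semilattice with a
  largest element \<open>t\<close>. Because \<open>c t\<close> lies below \<open>t\<close> for every \<open>c\<close>, the element \<open>y t\<close> depends only
  on the right cell of \<open>y\<close>. Choose a left cell \<open>L\<close> in a \<open>\<preceq>\<^sub>J\<close>-maximal two-sided cell that does not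
  annihilate \<open>M\<close>, with \<open>y t\<close> non-zero for some \<open>y\<close> in \<open>L\<close>. Sending a set of H-cells to the join
  of the \<open>y t\<close>, for \<open>y\<close> in one of these cells, is a surjective homomorphism onto \<open>M\<close>
  (\<open>isomorphic_reduced_cell_quotient\<close>).
\<close>

section \<open>Commuting matrices of non-negative integers\<close>

text \<open>An entry \<open>m y x\<close> is the weight of an arrow from \<open>x\<close> to \<open>y\<close>; the value below is the total weight
  of the walks of length \<open>n\<close> in \<open>J\<close> that start at \<open>x\<close>, that is, a column sum of the \<open>n\<close>-th power
  of \<open>m\<close>. For the transposed matrix it counts the walks that end at \<open>x\<close>.\<close>

primrec walk_weight :: "'a set \<Rightarrow> ('a \<Rightarrow> 'a \<Rightarrow> nat) \<Rightarrow> nat \<Rightarrow> 'a \<Rightarrow> nat" where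
  "walk_weight J m 0 x = 1"
| "walk_weight J m (Suc n) x = (\<Sum>z\<in>J. m z x * walk_weight J m n z)"

definition commuting_on :: "'a set \<Rightarrow> ('a \<Rightarrow> 'a \<Rightarrow> nat) \<Rightarrow> ('a \<Rightarrow> 'a \<Rightarrow> nat) \<Rightarrow> bool" where
  "commuting_on J m r \<longleftrightarrow>
     (\<forall>x\<in>J. \<forall>y\<in>J. (\<Sum>z\<in>J. m y z * r z x) = (\<Sum>z\<in>J. r y z * m z x))"

lemma commuting_on_transpose:
  assumes "commuting_on J m r"
  shows "commuting_on J (\<lambda>x y. m y x) (\<lambda>x y. r y x)"
  using assms unfolding commuting_on_def by (simp add: mult.commute)

text \<open>Since \<open>r\<close> commutes with powers of \<open>m\<close>, multiplying the row of column sums of \<open>m ^ n\<close> by \<open>r\<close>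
  is the same as summing the rows of \<open>r\<close> first, and these sums are bounded independently of \<open>n\<close>.\<close>

lemma walk_weight_commuting_le:
  assumes J: "finite J" and com: "commuting_on J m r" and x: "x \<in> J"
  shows "(\<Sum>z\<in>J. r z x * walk_weight J m n z)
           \<le> (\<Sum>u\<in>J. \<Sum>z\<in>J. r z u) * walk_weight J m n x"
  using x
proof (induction n arbitrary: x)
  case 0
  have "(\<Sum>z\<in>J. r z x) \<le> (\<Sum>u\<in>J. \<Sum>z\<in>J. r z u)"
    by (rule member_le_sum[OF 0, of "\<lambda>u. \<Sum>z\<in>J. r z u"]) (use J in auto)
  then show ?case by simp
next
  case (Suc n)
  let ?w = "walk_weight J m n" and ?K = "\<Sum>u\<in>J. \<Sum>z\<in>J. r z u"
  have "(\<Sum>z\<in>J. r z x * walk_weight J m (Suc n) z)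
          = (\<Sum>z\<in>J. \<Sum>u\<in>J. r z x * (m u z * ?w u))"
    by (simp add: sum_distrib_left)
  also have "\<dots> = (\<Sum>u\<in>J. \<Sum>z\<in>J. r z x * (m u z * ?w u))"
    by (rule sum.swap)
  also have "\<dots> = (\<Sum>u\<in>J. (\<Sum>z\<in>J. m u z * r z x) * ?w u)"
    by (simp add: sum_distrib_right sum_distrib_left mult_ac)
  also have "\<dots> = (\<Sum>u\<in>J. (\<Sum>z\<in>J. r u z * m z x) * ?w u)"
    using com Suc.prems unfolding commuting_on_def by (intro sum.cong) auto
  also have "\<dots> = (\<Sum>u\<in>J. \<Sum>z\<in>J. m z x * (r u z * ?w u))"
    by (simp add: sum_distrib_right sum_distrib_left mult_ac)
  also have "\<dots> = (\<Sum>z\<in>J. m z x * (\<Sum>u\<in>J. r u z * ?w u))"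
    by (subst sum.swap) (simp add: sum_distrib_left)
  also have "\<dots> \<le> (\<Sum>z\<in>J. m z x * (?K * ?w z))"
    by (intro sum_mono mult_left_mono Suc.IH) auto
  also have "\<dots> = ?K * walk_weight J m (Suc n) x"
    by (simp add: sum_distrib_left mult_ac)
  finally show ?case .
qed

lemma walk_weight_Suc_le:
  assumes "finite J" "x \<in> J"
  shows "walk_weight J m (Suc n) x \<le> (\<Sum>u\<in>J. \<Sum>z\<in>J. m z u) * walk_weight J m n x"
  using walk_weight_commuting_le[of J m m x n] assms by (simp add: commuting_on_def)

text \<open>Positivity of \<open>m r\<close> lets every \<open>y\<close> occur in the image of every \<open>x\<close> under \<open>m r\<close>, so the walks
  from \<open>y\<close> are bounded by those from \<open>m r x\<close>, which by commutation are boundedly many times those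
  from \<open>x\<close>. The point is that the constant does not depend on the length of the walks.\<close>

lemma walk_weight_comparable:
  assumes J: "finite J" and com: "commuting_on J m r"
    and pos: "\<And>x y. x \<in> J \<Longrightarrow> y \<in> J \<Longrightarrow> 0 < (\<Sum>z\<in>J. m y z * r z x)"
  shows "\<exists>K. \<forall>n. \<forall>x\<in>J. \<forall>y\<in>J. walk_weight J m n y \<le> K * walk_weight J m n x"
proof (intro exI allI ballI)
  fix n x y assume x: "x \<in> J" and y: "y \<in> J"
  let ?w = "walk_weight J m"
    and ?K = "\<Sum>u\<in>J. \<Sum>z\<in>J. r z u" and ?K' = "\<Sum>u\<in>J. \<Sum>z\<in>J. m z u"
  have "?w n y \<le> (\<Sum>z\<in>J. m y z * r z x) * ?w n y"
    using pos[OF x y] by simp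
  also have "\<dots> \<le> (\<Sum>u\<in>J. (\<Sum>z\<in>J. m u z * r z x) * ?w n u)"
    by (rule member_le_sum[OF y, of "\<lambda>u. (\<Sum>z\<in>J. m u z * r z x) * ?w n u"]) (use J in auto)
  also have "\<dots> = (\<Sum>u\<in>J. \<Sum>z\<in>J. r z x * (m u z * ?w n u))"
    by (simp add: sum_distrib_right sum_distrib_left mult_ac)
  also have "\<dots> = (\<Sum>z\<in>J. r z x * ?w (Suc n) z)"
    by (subst sum.swap) (simp add: sum_distrib_left)
  also have "\<dots> \<le> ?K * ?w (Suc n) x"
    by (rule walk_weight_commuting_le[OF J com x])
  also have "\<dots> \<le> ?K * (?K' * ?w n x)"
    by (intro mult_left_mono walk_weight_Suc_le[OF J x]) simp
  finally show "?w n y \<le> (?K * ?K') * ?w n x" by (simp add: mult.assoc)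
qed

lemma sum_walk_weight_shift:
  "(\<Sum>x\<in>J. walk_weight J m (Suc i) x * walk_weight J (\<lambda>x y. m y x) j x)
     = (\<Sum>x\<in>J. walk_weight J m i x * walk_weight J (\<lambda>x y. m y x) (Suc j) x)"
proof -
  let ?a = "walk_weight J m" and ?b = "walk_weight J (\<lambda>x y. m y x)"
  have "(\<Sum>x\<in>J. ?a (Suc i) x * ?b j x) = (\<Sum>x\<in>J. \<Sum>z\<in>J. ?a i z * (m z x * ?b j x))"
    by (simp add: sum_distrib_right sum_distrib_left mult_ac)
  also have "\<dots> = (\<Sum>z\<in>J. ?a i z * ?b (Suc j) z)"
    by (subst sum.swap) (simp add: sum_distrib_left)
  finally show ?thesis .
qed

lemma sum_walk_weight_pairing:
  "(\<Sum>x\<in>J. walk_weight J m i x * walk_weight J (\<lambda>x y. m y x) j x)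
     = (\<Sum>x\<in>J. walk_weight J m (i + j) x)"
proof (induction j arbitrary: i)
  case (Suc j)
  show ?case using Suc.IH[of "Suc i"] by (simp only: sum_walk_weight_shift) simp
qed simp

text \<open>Suppose that an arrow from \<open>x\<close> to \<open>y\<close> enters the closed set \<open>C\<close> from outside. A walk that
  takes it never leaves \<open>C\<close> again, so walks of length \<open>n + 1\<close> taking it at different times are
  different. Those taking it at time \<open>k\<close> consist of a walk of length \<open>k\<close> ending at \<open>x\<close> and one of
  length \<open>n - k\<close> starting at \<open>y\<close>; as all starting points are comparable, and all end points too,
  there are at least a constant times \<open>S k * S (n - k)\<close> of them, where \<open>S\<close> is the total number of
  walks. This is at least a constant times \<open>S n\<close>. Summing over \<open>k\<close>, the quotient \<open>S (n + 1) / S n\<close>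
  grows at least linearly in \<open>n\<close>, whereas it is bounded by the sum of the entries of \<open>m\<close>.\<close>

lemma closed_imp_backward_closed:
  fixes m r :: "'a \<Rightarrow> 'a \<Rightarrow> nat"
  assumes J: "finite J" and com: "commuting_on J m r"
    and pos: "\<And>x y. x \<in> J \<Longrightarrow> y \<in> J \<Longrightarrow> 0 < (\<Sum>z\<in>J. m y z * r z x)"
    and diag: "\<And>x. x \<in> J \<Longrightarrow> 0 < m x x"
    and C: "C \<subseteq> J"
    and closed: "\<And>c z. c \<in> C \<Longrightarrow> z \<in> J \<Longrightarrow> 0 < m z c \<Longrightarrow> z \<in> C"
    and yC: "y \<in> C" and xJ: "x \<in> J" and edge: "0 < m y x"
  shows "x \<in> C"
proof (rule ccontr)
  assume xC: "x \<notin> C"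
  have yJ: "y \<in> J" and finC: "finite C" using C yC J finite_subset by auto
  let ?a = "walk_weight J m" and ?b = "walk_weight J (\<lambda>x y. m y x)"
  define S where "S n = (\<Sum>x\<in>J. ?a n x)" for n
  obtain K where K: "\<And>n x y. x \<in> J \<Longrightarrow> y \<in> J \<Longrightarrow> ?a n y \<le> K * ?a n x"
    using walk_weight_comparable[OF J com pos] by blast
  have post: "0 < (\<Sum>z\<in>J. m z y * r x z)" if "x \<in> J" "y \<in> J" for x y
    using pos[OF that(2,1)] com that unfolding commuting_on_def by (simp add: mult.commute)
  obtain K' where K': "\<And>n x y. x \<in> J \<Longrightarrow> y \<in> J \<Longrightarrow> ?b n y \<le> K' * ?b n x"
    using walk_weight_comparable[OF J commuting_on_transpose[OF com] post] by blast
  define D where "D = (card J * K) * (card J * K')"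
  have Sb: "S n = (\<Sum>x\<in>J. ?b n x)" for n
    using sum_walk_weight_pairing[where m = m and i = 0 and j = n and J = J] by (simp add: S_def)
  have Sa_le: "S n \<le> card J * K * ?a n y" for n
    unfolding S_def using sum_mono[of J "?a n" "\<lambda>_. K * ?a n y"] K[OF yJ] by simp
  have Sb_le: "S n \<le> card J * K' * ?b n x" for n
    unfolding Sb using sum_mono[of J "?b n" "\<lambda>_. K' * ?b n x"] K'[OF xJ] by simp
  have submult: "S (i + j) \<le> S i * S j" for i j
  proof -
    have "S (i + j) = (\<Sum>u\<in>J. ?a i u * ?b j u)"
      by (simp add: S_def sum_walk_weight_pairing)
    also have "\<dots> \<le> (\<Sum>u\<in>J. ?a i u * S j)"
      unfolding Sb by (intro sum_mono mult_left_mono member_le_sum) (use J in auto)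
    finally show ?thesis by (simp add: S_def sum_distrib_right)
  qed
  have Spos: "0 < S n" for n
  proof -
    have "0 < ?a n y"
    proof (induction n)
      case (Suc n)
      have "0 < m y y * ?a n y" using diag[OF yJ] Suc by simp
      also have "\<dots> \<le> ?a (Suc n) y"
        using member_le_sum[OF yJ, of "\<lambda>z. m z y * ?a n z"] J by simp
      finally show ?case .
    qed simp
    then show ?thesis unfolding S_def using yJ J by (metis gr_zeroI sum_eq_0_iff not_less0)
  qed
  \<comment> \<open>Both sides concern walks of length \<open>n\<close>: the right side counts those that are in \<open>C\<close> after \<open>l\<close>
    steps, the left side those that entered \<open>C\<close> along the given arrow during the first \<open>l\<close> steps.\<close>
  have crossing: "(\<Sum>k<l. ?a (n - Suc k) y * ?b k x) \<le> (\<Sum>c\<in>C. ?a (n - l) c * ?b l c)"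
    if "l \<le> n" for n l
    using that
  proof (induction l)
    case (Suc l)
    define i where "i = n - Suc l"
    have i: "n - l = Suc i" using Suc.prems i_def by simp
    have "(\<Sum>c\<in>C. ?a (Suc i) c * ?b l c) = (\<Sum>c\<in>C. \<Sum>z\<in>J. ?a i z * (m z c * ?b l c))"
      by (simp add: sum_distrib_right sum_distrib_left mult_ac)
    also have "\<dots> = (\<Sum>c\<in>C. \<Sum>z\<in>C. ?a i z * (m z c * ?b l c))"
      by (intro sum.cong[OF refl] sum.mono_neutral_right)
        (use J C closed in auto)
    also have "\<dots> = (\<Sum>z\<in>C. ?a i z * (\<Sum>c\<in>C. m z c * ?b l c))"
      by (subst sum.swap) (simp add: sum_distrib_left)
    finally have 1: "(\<Sum>c\<in>C. ?a (Suc i) c * ?b l c)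
        = (\<Sum>z\<in>C. ?a i z * (\<Sum>c\<in>C. m z c * ?b l c))" .
    have 2: "(\<Sum>c\<in>C. m z c * ?b l c) + (if z = y then ?b l x else 0) \<le> ?b (Suc l) z" for z
    proof -
      have "(\<Sum>c\<in>C. m z c * ?b l c) + m z x * ?b l x = (\<Sum>c\<in>insert x C. m z c * ?b l c)"
        using finC xC by simp
      also have "\<dots> \<le> ?b (Suc l) z"
        using C xJ J by (auto intro: sum_mono2)
      finally show ?thesis using edge by (auto elim: order_trans[rotated])
    qed
    have "(\<Sum>k<Suc l. ?a (n - Suc k) y * ?b k x)
        \<le> (\<Sum>z\<in>C. ?a i z * (\<Sum>c\<in>C. m z c * ?b l c)) + ?a i y * ?b l x"
      using Suc 1 unfolding i by (simp add: i_def)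
    also have "\<dots> = (\<Sum>z\<in>C. ?a i z * ((\<Sum>c\<in>C. m z c * ?b l c) + (if z = y then ?b l x else 0)))"
      unfolding distrib_left sum.distrib using yC finC by (simp add: if_distrib cong: if_cong)
    also have "\<dots> \<le> (\<Sum>z\<in>C. ?a i z * ?b (Suc l) z)"
      by (intro sum_mono mult_left_mono 2) simp
    finally show ?case by (simp add: i_def)
  qed simp
  have linear: "Suc n * S n \<le> D * S (Suc n)" for n
  proof -
    have "Suc n * S n = (\<Sum>k<Suc n. S (n - k + k))" by simp
    also have "\<dots> \<le> (\<Sum>k<Suc n. S (n - k) * S k)"
      by (intro sum_mono submult)
    also have "\<dots> \<le> (\<Sum>k<Suc n. (card J * K * ?a (n - k) y) * (card J * K' * ?b k x))"
      by (intro sum_mono mult_mono Sa_le Sb_le) auto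
    also have "\<dots> = D * (\<Sum>k<Suc n. ?a (Suc n - Suc k) y * ?b k x)"
      by (simp only: sum_distrib_left D_def diff_Suc_Suc mult_ac)
    also have "\<dots> \<le> D * (\<Sum>c\<in>C. ?a (Suc n - Suc n) c * ?b (Suc n) c)"
      by (intro mult_left_mono crossing) auto
    also have "\<dots> \<le> D * S (Suc n)"
      unfolding Sb using C J by (intro mult_left_mono) (auto intro!: sum_mono2)
    finally show ?thesis .
  qed
  define K2 where "K2 = (\<Sum>u\<in>J. \<Sum>z\<in>J. m z u)"
  have "S (Suc n) \<le> K2 * S n" for n
    unfolding S_def sum_distrib_left
    using walk_weight_Suc_le[OF J] by (intro sum_mono) (simp only: K2_def)
  then have "Suc n * S n \<le> D * (K2 * S n)" for n
    using linear[of n] by (meson le_trans mult_le_mono2)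
  \<comment> \<open>The factor \<open>Suc n\<close> outgrows the constant already at \<open>n = D * K2\<close>.\<close>
  from this[of "D * K2"] Spos[of "D * K2"] show False by (simp add: mult_ac)
qed

text \<open>The set of points reachable from \<open>y\<close> is closed, hence closed backwards, and so it contains every
  \<open>x\<close> from which \<open>y\<close> is reachable.\<close>

lemma commuting_support_symmetric:
  fixes m r :: "'a \<Rightarrow> 'a \<Rightarrow> nat" and reach :: "'a \<Rightarrow> 'a \<Rightarrow> bool"
  assumes J: "finite J" and com: "commuting_on J m r"
    and pos: "\<And>x y. x \<in> J \<Longrightarrow> y \<in> J \<Longrightarrow> 0 < (\<Sum>z\<in>J. m y z * r z x)"
    and reach: "\<And>x y. x \<in> J \<Longrightarrow> y \<in> J \<Longrightarrow> 0 < m y x \<longleftrightarrow> reach x y"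
    and refl: "\<And>x. x \<in> J \<Longrightarrow> reach x x"
    and trans: "\<And>x y z. reach x y \<Longrightarrow> reach y z \<Longrightarrow> reach x z"
    and xy: "x \<in> J" "y \<in> J" "reach x y"
  shows "reach y x"
proof -
  have "x \<in> {z \<in> J. reach y z}"
  proof (rule closed_imp_backward_closed[where y = y, OF J com pos])
    show "0 < m u u" if "u \<in> J" for u
      using that reach refl by blast
    show "z \<in> {z \<in> J. reach y z}" if "c \<in> {z \<in> J. reach y z}" "z \<in> J" "0 < m z c" for c z
      using that reach[of c z] trans[of y c z] by simp
  qed (use xy reach refl in auto)
  then show ?thesis by simp
qed

section \<open>Quotients of semimodules\<close>

lemma subsemimoduleD:
  assumes "subsemimodule N R M"
  shows "N \<subseteq> carrier M" "\<zero>\<^bsub>M\<^esub> \<in> N"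
    and "x \<in> N \<Longrightarrow> y \<in> N \<Longrightarrow> x \<oplus>\<^bsub>M\<^esub> y \<in> N"
    and "a \<in> carrier R \<Longrightarrow> x \<in> N \<Longrightarrow> a \<odot>\<^bsub>M\<^esub> x \<in> N"
  using assms submonoid.subset[of N "add_monoid M"] submonoid.one_closed[of N "add_monoid M"]
    submonoid.m_closed[of N "add_monoid M" x y]
  by (auto simp: subsemimodule_def)

lemma semimodule_congruenceD:
  assumes "semimodule_congruence R N E"
  shows "equiv (carrier N) E"
    and "(x, y) \<in> E \<Longrightarrow> z \<in> carrier N \<Longrightarrow> (x \<oplus>\<^bsub>N\<^esub> z, y \<oplus>\<^bsub>N\<^esub> z) \<in> E"
    and "(x, y) \<in> E \<Longrightarrow> a \<in> carrier R \<Longrightarrow> (a \<odot>\<^bsub>N\<^esub> x, a \<odot>\<^bsub>N\<^esub> y) \<in> E"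
  using assms unfolding semimodule_congruence_def by auto

lemma quotient_semimodule_simps:
  "carrier (quotient_semimodule N E) = carrier N // E"
  "\<zero>\<^bsub>quotient_semimodule N E\<^esub> = E `` {\<zero>\<^bsub>N\<^esub>}"
  by (simp_all add: quotient_semimodule_def)

context semimodule
begin

lemma quotient_add_class:
  assumes E: "semimodule_congruence R M E" and x: "x \<in> carrier M" and y: "y \<in> carrier M"
  shows "E `` {x} \<oplus>\<^bsub>quotient_semimodule M E\<^esub> E `` {y} = E `` {x \<oplus>\<^bsub>M\<^esub> y}"
proof -
  note eq = semimodule_congruenceD(1)[OF E]
  have "E `` {x' \<oplus>\<^bsub>M\<^esub> y'} = E `` {x \<oplus>\<^bsub>M\<^esub> y}" if "(x, x') \<in> E" "(y, y') \<in> E" for x' y'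
  proof -
    have c: "x' \<in> carrier M" "y' \<in> carrier M" using that equiv_type[OF eq] by auto
    have "(x \<oplus>\<^bsub>M\<^esub> y, x' \<oplus>\<^bsub>M\<^esub> y) \<in> E"
      by (rule semimodule_congruenceD(2)[OF E that(1) y])
    moreover have "(x' \<oplus>\<^bsub>M\<^esub> y, x' \<oplus>\<^bsub>M\<^esub> y') \<in> E"
      using semimodule_congruenceD(2)[OF E that(2) c(1)] c y by (simp add: M.a_comm)
    ultimately have "(x \<oplus>\<^bsub>M\<^esub> y, x' \<oplus>\<^bsub>M\<^esub> y') \<in> E"
      using eq unfolding equiv_def by (blast dest: transD)
    then show ?thesis using equiv_class_eq[OF eq] by blast
  qed
  then have "(\<Union>x'\<in>E `` {x}. \<Union>y'\<in>E `` {y}. E `` {x' \<oplus>\<^bsub>M\<^esub> y'})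
      = (\<Union>x'\<in>E `` {x}. \<Union>y'\<in>E `` {y}. E `` {x \<oplus>\<^bsub>M\<^esub> y})"
    by (intro SUP_cong refl) blast
  moreover have "E `` {x} \<noteq> {}" "E `` {y} \<noteq> {}"
    using equiv_class_self[OF eq] x y by blast+
  ultimately show ?thesis by (simp add: quotient_semimodule_def)
qed

lemma quotient_smult_class:
  assumes E: "semimodule_congruence R M E" and a: "a \<in> carrier R" and x: "x \<in> carrier M"
  shows "a \<odot>\<^bsub>quotient_semimodule M E\<^esub> E `` {x} = E `` {a \<odot>\<^bsub>M\<^esub> x}"
proof -
  note eq = semimodule_congruenceD(1)[OF E]
  have "E `` {a \<odot>\<^bsub>M\<^esub> x'} = E `` {a \<odot>\<^bsub>M\<^esub> x}" if "(x, x') \<in> E" for x'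
    using semimodule_congruenceD(3)[OF E that a] equiv_class_eq[OF eq] by blast
  then have "(\<Union>x'\<in>E `` {x}. E `` {a \<odot>\<^bsub>M\<^esub> x'}) = (\<Union>x'\<in>E `` {x}. E `` {a \<odot>\<^bsub>M\<^esub> x})"
    by (intro SUP_cong refl) blast
  moreover have "E `` {x} \<noteq> {}" using equiv_class_self[OF eq] x by blast
  ultimately show ?thesis by (simp add: quotient_semimodule_def)
qed

lemma semimodule_quotient:
  assumes E: "semimodule_congruence R M E"
  shows "semimodule R (quotient_semimodule M E)" (is "semimodule R ?Q")
proof -
  note add = quotient_add_class[OF E] and smult = quotient_smult_class[OF E]
  have repE: thesis if "X \<in> carrier ?Q" "\<And>x. x \<in> carrier M \<Longrightarrow> X = E `` {x} \<Longrightarrow> thesis" for X thesis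
    using that unfolding quotient_semimodule_simps by (blast elim: quotientE)
  have cls: "E `` {x} \<in> carrier ?Q" if "x \<in> carrier M" for x
    using that by (simp add: quotient_semimodule_simps quotientI)
  have zero: "\<zero>\<^bsub>?Q\<^esub> = E `` {\<zero>\<^bsub>M\<^esub>}" by (simp add: quotient_semimodule_simps)
  note simps = add smult zero smult_closed smult_r_distr smult_l_distr smult_assoc smult_zero
    zero_smult one_smult cls M.a_closed
  show ?thesis
  proof (intro semimodule.intro semimodule_axioms.intro abelian_monoidI)
    show "semiring R" by (rule R.semiring_axioms)
  qed ((elim repE)?, simp add: simps M.a_ac)+
qed

text \<open>The preimage of a subsemimodule of the quotient is a subsemimodule.\<close>

lemma minimal_semimodule_quotient:
  assumes min: "minimal_semimodule R M" and E: "semimodule_congruence R M E"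
    and nonzero: "carrier (quotient_semimodule M E) \<noteq> {\<zero>\<^bsub>quotient_semimodule M E\<^esub>}"
  shows "minimal_semimodule R (quotient_semimodule M E)" (is "minimal_semimodule R ?Q")
  unfolding minimal_semimodule_def
proof (intro conjI allI impI)
  show "semimodule R ?Q" by (rule semimodule_quotient[OF E])
  show "carrier ?Q \<noteq> {\<zero>\<^bsub>?Q\<^esub>}" by (rule nonzero)
  fix N assume N: "subsemimodule N R ?Q"
  then have sub: "N \<subseteq> carrier ?Q" and N_zero: "\<zero>\<^bsub>?Q\<^esub> \<in> N"
    and N_add: "\<And>X Y. X \<in> N \<Longrightarrow> Y \<in> N \<Longrightarrow> X \<oplus>\<^bsub>?Q\<^esub> Y \<in> N"
    and N_smult: "\<And>a X. a \<in> carrier R \<Longrightarrow> X \<in> N \<Longrightarrow> a \<odot>\<^bsub>?Q\<^esub> X \<in> N"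
    using subsemimoduleD[OF N] by blast+
  let ?P = "{x \<in> carrier M. E `` {x} \<in> N}"
  have "subsemimodule ?P R M"
    unfolding subsemimodule_def
  proof (intro conjI submonoid.intro ballI)
    show "x \<otimes>\<^bsub>add_monoid M\<^esub> y \<in> ?P" if "x \<in> ?P" "y \<in> ?P" for x y
      using that N_add[of "E `` {x}" "E `` {y}"] by (simp add: quotient_add_class[OF E])
    show "a \<odot>\<^bsub>M\<^esub> x \<in> ?P" if "a \<in> carrier R" "x \<in> ?P" for a x
      using that N_smult[of a "E `` {x}"] by (simp add: quotient_smult_class[OF E] smult_closed)
  qed (use N_zero in \<open>auto simp: quotient_semimodule_simps\<close>)
  then consider "?P = {\<zero>\<^bsub>M\<^esub>}" | "?P = carrier M"
    using min unfolding minimal_semimodule_def by blast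
  then show "N = {\<zero>\<^bsub>?Q\<^esub>} \<or> N = carrier ?Q"
  proof cases
    case 1
    have "X = \<zero>\<^bsub>?Q\<^esub>" if "X \<in> N" for X
    proof -
      obtain x where x: "x \<in> carrier M" "X = E `` {x}"
        by (rule quotientE[OF subsetD[OF sub \<open>X \<in> N\<close>, unfolded quotient_semimodule_simps]])
      then have "x \<in> ?P" using that by simp
      then show ?thesis using 1 x by (simp add: quotient_semimodule_simps)
    qed
    then show ?thesis using N_zero by blast
  next
    case 2
    have "X \<in> N" if "X \<in> carrier ?Q" for X
    proof -
      obtain x where x: "x \<in> carrier M" "X = E `` {x}"
        by (rule quotientE[OF \<open>X \<in> carrier ?Q\<close>[unfolded quotient_semimodule_simps]])
      then show ?thesis using 2 by blast
    qed
    then show ?thesis using sub by blast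
  qed
qed

lemma surjective_hom_quotient_isomorphic:
  fixes N :: "('a, 'n, 'z) module_scheme"
  assumes surj: "\<phi> ` carrier M = carrier N" and zero: "\<phi> \<zero>\<^bsub>M\<^esub> = \<zero>\<^bsub>N\<^esub>"
    and add: "\<And>x y. x \<in> carrier M \<Longrightarrow> y \<in> carrier M \<Longrightarrow> \<phi> (x \<oplus>\<^bsub>M\<^esub> y) = \<phi> x \<oplus>\<^bsub>N\<^esub> \<phi> y"
    and smult: "\<And>a x. a \<in> carrier R \<Longrightarrow> x \<in> carrier M \<Longrightarrow> \<phi> (a \<odot>\<^bsub>M\<^esub> x) = a \<odot>\<^bsub>N\<^esub> \<phi> x"
  shows "\<exists>E. semimodule_congruence R M E \<and> semimodule_isomorphic R N (quotient_semimodule M E)"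
proof (intro exI conjI)
  let ?E = "{(x, y) \<in> carrier M \<times> carrier M. \<phi> x = \<phi> y}"
  have "equiv (carrier M) ?E"
    by (auto intro!: equivI refl_onI symI transI)
  then show E: "semimodule_congruence R M ?E"
    unfolding semimodule_congruence_def by (auto simp: add smult smult_closed)
  let ?f = "\<lambda>n. {x \<in> carrier M. \<phi> x = n}"
  have f: "?f (\<phi> x) = ?E `` {x}" if "x \<in> carrier M" for x
    using that by auto
  have rep: "\<exists>x\<in>carrier M. n = \<phi> x" if "n \<in> carrier N" for n
    using that surj by auto
  let ?Q = "quotient_semimodule M ?E"
  have "bij_betw ?f (carrier N) (carrier ?Q)"
    unfolding bij_betw_def
  proof (intro conjI inj_onI)
    fix n n' assume "n \<in> carrier N" "n' \<in> carrier N" "?f n = ?f n'"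
    then show "n = n'" using rep by fastforce
  next
    have "?f ` carrier N = (\<lambda>x. ?f (\<phi> x)) ` carrier M"
      by (simp add: image_image flip: surj)
    also have "\<dots> = (\<lambda>x. ?E `` {x}) ` carrier M" by (intro image_cong refl f)
    also have "\<dots> = carrier ?Q"
      by (auto simp: quotient_semimodule_simps quotient_def)
    finally show "?f ` carrier N = carrier ?Q" .
  qed
  moreover have "?f \<zero>\<^bsub>N\<^esub> = \<zero>\<^bsub>?Q\<^esub>"
    using f[OF M.zero_closed] by (simp add: zero quotient_semimodule_simps)
  moreover have "?f (n \<oplus>\<^bsub>N\<^esub> n') = ?f n \<oplus>\<^bsub>?Q\<^esub> ?f n'" if "n \<in> carrier N" "n' \<in> carrier N" for n n'
  proof -
    obtain x x' where x: "x \<in> carrier M" "x' \<in> carrier M" "n = \<phi> x" "n' = \<phi> x'"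
      using rep \<open>n \<in> carrier N\<close> \<open>n' \<in> carrier N\<close> by blast
    have "?f (n \<oplus>\<^bsub>N\<^esub> n') = ?E `` {x \<oplus>\<^bsub>M\<^esub> x'}"
      using f[of "x \<oplus>\<^bsub>M\<^esub> x'"] x by (simp only: add M.a_closed)
    also have "\<dots> = ?f n \<oplus>\<^bsub>?Q\<^esub> ?f n'"
      using x by (simp only: f quotient_add_class[OF E])
    finally show ?thesis .
  qed
  moreover have "?f (a \<odot>\<^bsub>N\<^esub> n) = a \<odot>\<^bsub>?Q\<^esub> ?f n" if "a \<in> carrier R" "n \<in> carrier N" for a n
  proof -
    obtain x where x: "x \<in> carrier M" "n = \<phi> x"
      using rep \<open>n \<in> carrier N\<close> by blast
    have "?f (a \<odot>\<^bsub>N\<^esub> n) = ?E `` {a \<odot>\<^bsub>M\<^esub> x}"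
      using f[of "a \<odot>\<^bsub>M\<^esub> x"] x that by (simp only: smult smult_closed)
    also have "\<dots> = a \<odot>\<^bsub>?Q\<^esub> ?f n"
      using x that by (simp only: f quotient_smult_class[OF E])
    finally show ?thesis .
  qed
  ultimately show "semimodule_isomorphic R N ?Q"
    unfolding semimodule_isomorphic_def by (intro exI[of _ ?f] conjI ballI) blast+
qed

end

section \<open>Coefficients and supports\<close>

context fg_nat_semiring
begin

abbreviation coeff :: "'a \<Rightarrow> 'a \<Rightarrow> nat" where
  "coeff \<equiv> basis_coeff R B"

definition supp :: "'a \<Rightarrow> 'a set" where
  "supp a = {b \<in> B. coeff a b \<noteq> 0}"

lemma lin_comb_closed: "lin_comb R B c \<in> carrier R"
  unfolding lin_comb_def using basis_closed by (intro finsum_closed) (auto intro: add.nat_pow_closed)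

lemma lin_comb_cong: "(\<And>b. b \<in> B \<Longrightarrow> c b = d b) \<Longrightarrow> lin_comb R B c = lin_comb R B d"
  unfolding lin_comb_def using basis_closed
  by (intro finsum_cong') (auto intro: add.nat_pow_closed)

lemma lin_comb_coeff: "a \<in> carrier R \<Longrightarrow> lin_comb R B (coeff a) = a"
  using theI'[OF unique_lin_comb[of a]] unfolding basis_coeff_def by auto

lemma coeff_lin_comb: "b \<in> B \<Longrightarrow> coeff (lin_comb R B c) b = c b"
proof -
  assume b: "b \<in> B"
  have "lin_comb R B c = lin_comb R B (restrict c B)" by (rule lin_comb_cong) simp
  then have "coeff (lin_comb R B c) = restrict c B"
    unfolding basis_coeff_def
    by (intro the1_equality unique_lin_comb[OF lin_comb_closed]) auto
  then show ?thesis using b by simp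
qed

lemma coeff_add:
  assumes "a \<in> carrier R" "a' \<in> carrier R" "b \<in> B"
  shows "coeff (a \<oplus> a') b = coeff a b + coeff a' b"
proof -
  have "lin_comb R B (\<lambda>b. coeff a b + coeff a' b) = lin_comb R B (coeff a) \<oplus> lin_comb R B (coeff a')"
    unfolding lin_comb_def using basis_closed
    by (subst finsum_addf[symmetric])
      (auto intro!: finsum_cong' add.nat_pow_closed a_closed simp: add.nat_pow_mult)
  then show ?thesis
    using assms coeff_lin_comb[OF assms(3), of "\<lambda>b. coeff a b + coeff a' b"]
    by (simp add: lin_comb_coeff)
qed

lemma coeff_zero: "b \<in> B \<Longrightarrow> coeff \<zero> b = 0"
  using coeff_add[of \<zero> \<zero> b] by simp

lemma coeff_basis: "b \<in> B \<Longrightarrow> b' \<in> B \<Longrightarrow> coeff b b' = (if b' = b then 1 else 0)"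
proof -
  assume b: "b \<in> B" "b' \<in> B"
  let ?c = "\<lambda>x. if x = b then 1 else 0"
  have "lin_comb R B ?c = (\<Oplus>x\<in>B. if b = x then x else \<zero>)"
    unfolding lin_comb_def using basis_closed by (intro finsum_cong') auto
  also have "\<dots> = b"
    using b finite_basis basis_closed by (intro add.finprod_singleton) auto
  finally have "lin_comb R B ?c = b" .
  then show ?thesis using coeff_lin_comb[OF b(2), of ?c] by (simp only:)
qed

lemma supp_subset: "supp a \<subseteq> B" by (auto simp: supp_def)

lemma supp_add: "a \<in> carrier R \<Longrightarrow> a' \<in> carrier R \<Longrightarrow> supp (a \<oplus> a') = supp a \<union> supp a'"
  by (auto simp: supp_def coeff_add)

lemma supp_zero: "supp \<zero> = {}" by (auto simp: supp_def coeff_zero)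

lemma supp_basis: "b \<in> B \<Longrightarrow> supp b = {b}" by (auto simp: supp_def coeff_basis split: if_splits)

definition basis_sum :: "'a set \<Rightarrow> 'a" where
  "basis_sum S = lin_comb R B (\<lambda>b. if b \<in> S then 1 else 0)"

lemma basis_sum_closed [simp]: "basis_sum S \<in> carrier R"
  by (simp add: basis_sum_def lin_comb_closed)

lemma supp_basis_sum: "S \<subseteq> B \<Longrightarrow> supp (basis_sum S) = S"
  by (auto simp: supp_def basis_sum_def coeff_lin_comb split: if_splits)

lemma finsum_mem_closed:
  assumes "finite S" and "f \<in> S \<rightarrow> carrier R" and "P \<zero>"
    and "\<And>x. x \<in> S \<Longrightarrow> P (f x)"
    and "\<And>x y. x \<in> carrier R \<Longrightarrow> y \<in> carrier R \<Longrightarrow> P x \<Longrightarrow> P y \<Longrightarrow> P (x \<oplus> y)"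
  shows "P (finsum R f S)"
  using assms(1,2,4)
proof (induction S rule: finite_induct)
  case (insert x F)
  then show ?case using assms(5) by (auto simp: Pi_iff)
qed (simp add: assms(3))

text \<open>The induction principle behind most arguments on elements of the semiring: the basis elements
  needed are only those in the support, each taken as often as its coefficient says.\<close>

lemma supp_induct:
  assumes a: "a \<in> carrier R" and zero: "P \<zero>"
    and basis: "\<And>b. b \<in> supp a \<Longrightarrow> P b"
    and add: "\<And>x y. x \<in> carrier R \<Longrightarrow> y \<in> carrier R \<Longrightarrow> P x \<Longrightarrow> P y \<Longrightarrow> P (x \<oplus> y)"
  shows "P a"
proof -
  have mult: "P ([n] \<cdot> b)" if "b \<in> supp a" for b and n :: nat
    using that basis basis_closed supp_subset
    by (induction n) (auto intro!: add zero add.nat_pow_closed)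
  have "P (lin_comb R B (coeff a))"
    unfolding lin_comb_def
  proof (rule finsum_mem_closed[OF finite_basis _ zero _ add])
    fix b assume "b \<in> B"
    then show "P ([coeff a b] \<cdot> b)"
      using mult zero by (cases "coeff a b = 0") (auto simp: supp_def)
  qed (use basis_closed in \<open>auto intro: add.nat_pow_closed\<close>)
  then show ?thesis using lin_comb_coeff[OF a] by simp
qed

lemma supp_split:
  assumes a: "a \<in> carrier R" and b: "b \<in> supp a"
  shows "\<exists>a'\<in>carrier R. a = b \<oplus> a'"
proof -
  have bB: "b \<in> B" and pos: "coeff a b > 0" using b by (auto simp: supp_def)
  let ?a' = "lin_comb R B (\<lambda>x. coeff a x - (if x = b then 1 else 0))"
  have "a = lin_comb R B (coeff a)" using lin_comb_coeff[OF a] by simp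
  also have "\<dots> = lin_comb R B (coeff (b \<oplus> ?a'))"
    using bB pos basis_closed
    by (intro lin_comb_cong) (auto simp: coeff_add lin_comb_closed coeff_basis coeff_lin_comb)
  also have "\<dots> = b \<oplus> ?a'"
    using bB basis_closed lin_comb_closed by (intro lin_comb_coeff) auto
  finally show ?thesis using lin_comb_closed by blast
qed

text \<open>Used for the coefficient functions of left and right multiplication by a fixed element.\<close>

lemma additive_eq_sum_coeff:
  fixes h :: "'a \<Rightarrow> nat"
  assumes a: "a \<in> carrier R" and zero: "h \<zero> = 0"
    and add: "\<And>x y. x \<in> carrier R \<Longrightarrow> y \<in> carrier R \<Longrightarrow> h (x \<oplus> y) = h x + h y"
  shows "h a = (\<Sum>b\<in>B. coeff a b * h b)"
  using a
proof (rule supp_induct)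
  show "h \<zero> = (\<Sum>b\<in>B. coeff \<zero> b * h b)" by (simp add: zero coeff_zero)
next
  fix b assume "b \<in> supp a"
  then have b: "b \<in> B" using supp_subset by auto
  then have "(\<Sum>x\<in>B. coeff b x * h x) = (\<Sum>x\<in>B. if x = b then h x else 0)"
    by (intro sum.cong) (auto simp: coeff_basis)
  then show "h b = (\<Sum>x\<in>B. coeff b x * h x)" using b finite_basis by simp
next
  fix x y
  assume "x \<in> carrier R" "y \<in> carrier R"
    and "h x = (\<Sum>b\<in>B. coeff x b * h b)" "h y = (\<Sum>b\<in>B. coeff y b * h b)"
  then show "h (x \<oplus> y) = (\<Sum>b\<in>B. coeff (x \<oplus> y) b * h b)"
    by (simp add: add coeff_add distrib_right sum.distrib)
qed

lemma coeff_mult_left: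
  assumes "a \<in> carrier R" "c \<in> carrier R" "y \<in> B"
  shows "coeff (a \<otimes> c) y = (\<Sum>z\<in>B. coeff c z * coeff (a \<otimes> z) y)"
  using assms by (intro additive_eq_sum_coeff) (auto simp: r_distr coeff_add coeff_zero)

lemma coeff_mult_right:
  assumes "a \<in> carrier R" "c \<in> carrier R" "y \<in> B"
  shows "coeff (a \<otimes> c) y = (\<Sum>z\<in>B. coeff a z * coeff (z \<otimes> c) y)"
  using assms by (intro additive_eq_sum_coeff[where h = "\<lambda>a. coeff (a \<otimes> c) y"])
    (auto simp: l_distr coeff_add coeff_zero)

text \<open>A sum of non-negative integers vanishes only if all its terms do, so the support of a product
  does not depend on the values of the coefficients.\<close>

lemma supp_mult_left:
  "a \<in> carrier R \<Longrightarrow> c \<in> carrier R \<Longrightarrow> supp (a \<otimes> c) = (\<Union>z\<in>supp c. supp (a \<otimes> z))"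
proof -
  assume "a \<in> carrier R" "c \<in> carrier R"
  then have "coeff (a \<otimes> c) y \<noteq> 0 \<longleftrightarrow> (\<exists>z\<in>B. coeff c z \<noteq> 0 \<and> coeff (a \<otimes> z) y \<noteq> 0)" if "y \<in> B" for y
    using that by (simp only: coeff_mult_left sum_eq_0_iff[OF finite_basis]) simp
  then show ?thesis unfolding supp_def by blast
qed

lemma supp_mult_right:
  "a \<in> carrier R \<Longrightarrow> c \<in> carrier R \<Longrightarrow> supp (a \<otimes> c) = (\<Union>z\<in>supp a. supp (z \<otimes> c))"
proof -
  assume "a \<in> carrier R" "c \<in> carrier R"
  then have "coeff (a \<otimes> c) y \<noteq> 0 \<longleftrightarrow> (\<exists>z\<in>B. coeff a z \<noteq> 0 \<and> coeff (z \<otimes> c) y \<noteq> 0)" if "y \<in> B" for y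
    using that by (simp only: coeff_mult_right sum_eq_0_iff[OF finite_basis]) simp
  then show ?thesis unfolding supp_def by blast
qed

lemma basis_in_carrier: "b \<in> B \<Longrightarrow> b \<in> carrier R" using basis_closed by auto

lemma supp_in_carrier: "b \<in> supp a \<Longrightarrow> b \<in> carrier R"
  using basis_closed supp_subset by auto

lemma supp_mult_mono:
  assumes "a \<in> carrier R" "a' \<in> carrier R" "c \<in> carrier R" "c' \<in> carrier R"
    and "supp a \<subseteq> supp a'" "supp c \<subseteq> supp c'"
  shows "supp (a \<otimes> c) \<subseteq> supp (a' \<otimes> c')"
proof -
  have "supp (a \<otimes> c) \<subseteq> supp (a' \<otimes> c)"
    using assms by (auto simp: supp_mult_right)
  also have "\<dots> \<subseteq> supp (a' \<otimes> c')"
    using assms by (auto simp: supp_mult_left)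
  finally show ?thesis .
qed

section \<open>The cell preorders and their stability\<close>

text \<open>The relations \<open>x \<preceq> y\<close> go from generators to the elements they generate: larger elements lie in
  smaller ideals.\<close>

definition le_L (infix "\<preceq>\<^sub>L" 50) where "x \<preceq>\<^sub>L y \<longleftrightarrow> (x, y) \<in> left_preorder R B"
definition le_R (infix "\<preceq>\<^sub>R" 50) where "x \<preceq>\<^sub>R y \<longleftrightarrow> (x, y) \<in> right_preorder R B"
definition le_J (infix "\<preceq>\<^sub>J" 50) where "x \<preceq>\<^sub>J y \<longleftrightarrow> (x, y) \<in> two_sided_preorder R B"

lemma le_L_iff: "x \<preceq>\<^sub>L y \<longleftrightarrow> x \<in> B \<and> (\<exists>a\<in>carrier R. y \<in> supp (a \<otimes> x))"
  and le_R_iff: "x \<preceq>\<^sub>R y \<longleftrightarrow> x \<in> B \<and> (\<exists>a\<in>carrier R. y \<in> supp (x \<otimes> a))"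
  and le_J_iff: "x \<preceq>\<^sub>J y \<longleftrightarrow>
    x \<in> B \<and> (\<exists>a\<in>carrier R. \<exists>a'\<in>carrier R. y \<in> supp (a \<otimes> x \<otimes> a'))"
  by (auto simp: le_L_def le_R_def le_J_def left_preorder_def right_preorder_def
      two_sided_preorder_def supp_def)

lemma le_LI: "x \<in> B \<Longrightarrow> a \<in> carrier R \<Longrightarrow> y \<in> supp (a \<otimes> x) \<Longrightarrow> x \<preceq>\<^sub>L y"
  and le_RI: "x \<in> B \<Longrightarrow> a \<in> carrier R \<Longrightarrow> y \<in> supp (x \<otimes> a) \<Longrightarrow> x \<preceq>\<^sub>R y"
  by (auto simp: le_L_iff le_R_iff)

lemma le_L_refl: "x \<in> B \<Longrightarrow> x \<preceq>\<^sub>L x"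
  by (rule le_LI[of _ \<one>]) (auto simp: supp_basis basis_in_carrier)

lemma le_R_refl: "x \<in> B \<Longrightarrow> x \<preceq>\<^sub>R x"
  by (rule le_RI[of _ \<one>]) (auto simp: supp_basis basis_in_carrier)

lemma le_L_basis: "x \<preceq>\<^sub>L y \<Longrightarrow> x \<in> B \<and> y \<in> B"
  and le_R_basis: "x \<preceq>\<^sub>R y \<Longrightarrow> x \<in> B \<and> y \<in> B"
  and le_J_basis: "x \<preceq>\<^sub>J y \<Longrightarrow> x \<in> B \<and> y \<in> B"
  using supp_subset by (auto simp: le_L_iff le_R_iff le_J_iff)

lemma le_L_trans: "x \<preceq>\<^sub>L y \<Longrightarrow> y \<preceq>\<^sub>L z \<Longrightarrow> x \<preceq>\<^sub>L z"
proof -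
  assume "x \<preceq>\<^sub>L y" "y \<preceq>\<^sub>L z"
  then obtain a a' where *: "x \<in> B" "a \<in> carrier R" "y \<in> supp (a \<otimes> x)"
    "a' \<in> carrier R" "z \<in> supp (a' \<otimes> y)" by (auto simp: le_L_iff)
  then have "z \<in> supp (a' \<otimes> (a \<otimes> x))"
    by (subst supp_mult_left) (auto simp: basis_in_carrier)
  then show ?thesis using * by (intro le_LI[of _ "a' \<otimes> a"]) (auto simp: m_assoc basis_in_carrier)
qed

lemma le_R_trans: "x \<preceq>\<^sub>R y \<Longrightarrow> y \<preceq>\<^sub>R z \<Longrightarrow> x \<preceq>\<^sub>R z"
proof -
  assume "x \<preceq>\<^sub>R y" "y \<preceq>\<^sub>R z"
  then obtain a a' where *: "x \<in> B" "a \<in> carrier R" "y \<in> supp (x \<otimes> a)"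
    "a' \<in> carrier R" "z \<in> supp (y \<otimes> a')" by (auto simp: le_R_iff)
  then have "z \<in> supp ((x \<otimes> a) \<otimes> a')"
    by (subst supp_mult_right) (auto simp: basis_in_carrier)
  then show ?thesis using * by (intro le_RI[of _ "a \<otimes> a'"]) (auto simp: m_assoc basis_in_carrier)
qed

lemma le_J_iff_le_L_le_R: "x \<preceq>\<^sub>J y \<longleftrightarrow> (\<exists>z. x \<preceq>\<^sub>L z \<and> z \<preceq>\<^sub>R y)"
proof
  assume "x \<preceq>\<^sub>J y"
  then obtain a a' where *: "x \<in> B" "a \<in> carrier R" "a' \<in> carrier R" "y \<in> supp (a \<otimes> x \<otimes> a')"
    by (auto simp: le_J_iff)
  then obtain z where "z \<in> supp (a \<otimes> x)" "y \<in> supp (z \<otimes> a')"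
    by (auto simp: supp_mult_right[of "a \<otimes> x"] basis_in_carrier)
  then show "\<exists>z. x \<preceq>\<^sub>L z \<and> z \<preceq>\<^sub>R y"
    using * supp_subset by (blast intro: le_LI le_RI)
next
  assume "\<exists>z. x \<preceq>\<^sub>L z \<and> z \<preceq>\<^sub>R y"
  then obtain z a a' where *: "x \<in> B" "a \<in> carrier R" "z \<in> supp (a \<otimes> x)" "a' \<in> carrier R"
    "y \<in> supp (z \<otimes> a')"
    by (auto simp: le_L_iff le_R_iff)
  then have "y \<in> supp (a \<otimes> x \<otimes> a')"
    by (subst supp_mult_right) (auto simp: basis_in_carrier)
  then show "x \<preceq>\<^sub>J y" using * by (auto simp: le_J_iff)
qed

lemma le_R_le_L_commute: "x \<preceq>\<^sub>R z \<Longrightarrow> z \<preceq>\<^sub>L y \<Longrightarrow> \<exists>z'. x \<preceq>\<^sub>L z' \<and> z' \<preceq>\<^sub>R y"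
proof -
  assume "x \<preceq>\<^sub>R z" "z \<preceq>\<^sub>L y"
  then obtain a a' where *: "x \<in> B" "a \<in> carrier R" "z \<in> supp (x \<otimes> a)"
    "a' \<in> carrier R" "y \<in> supp (a' \<otimes> z)" by (auto simp: le_L_iff le_R_iff)
  then have "y \<in> supp (a' \<otimes> (x \<otimes> a))"
    by (subst supp_mult_left) (auto simp: basis_in_carrier)
  then have "x \<preceq>\<^sub>J y" using * by (auto simp: le_J_iff m_assoc basis_in_carrier)
  then show ?thesis by (simp add: le_J_iff_le_L_le_R)
qed

lemma le_J_trans: "x \<preceq>\<^sub>J y \<Longrightarrow> y \<preceq>\<^sub>J z \<Longrightarrow> x \<preceq>\<^sub>J z"
  unfolding le_J_iff_le_L_le_R by (meson le_R_le_L_commute le_L_trans le_R_trans)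

lemma le_L_imp_le_J: "x \<preceq>\<^sub>L y \<Longrightarrow> x \<preceq>\<^sub>J y"
  and le_R_imp_le_J: "x \<preceq>\<^sub>R y \<Longrightarrow> x \<preceq>\<^sub>J y"
  using le_L_basis le_R_basis le_L_refl le_R_refl unfolding le_J_iff_le_L_le_R by blast+

lemma le_J_refl: "x \<in> B \<Longrightarrow> x \<preceq>\<^sub>J x"
  using le_L_refl le_L_imp_le_J by blast

lemma coeff_pos_iff: "y \<in> B \<Longrightarrow> 0 < coeff a y \<longleftrightarrow> y \<in> supp a"
  by (auto simp: supp_def)


lemma basis_sum_absorbs:
  assumes "a \<in> carrier R" "x \<in> B"
  shows "supp (a \<otimes> x) \<subseteq> supp (basis_sum B \<otimes> x)" and "supp (x \<otimes> a) \<subseteq> supp (x \<otimes> basis_sum B)"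
  using assms supp_subset
  by (intro supp_mult_mono; auto simp: supp_basis_sum basis_in_carrier)+

text \<open>Any basis element occurring between two elements of a two-sided cell \<open>J\<close> lies in \<open>J\<close>. So the
  matrices of left and right multiplication can be truncated to \<open>J\<close> without changing their
  products there, which makes them commute by associativity. Their product is the matrix of
  \<open>x \<mapsto> f x f\<close>, whose entries on \<open>J\<close> are positive by the definition of a two-sided cell.\<close>

lemma two_sided_class_matrices:
  fixes J f
  defines "f \<equiv> basis_sum B"
  assumes J: "J = {z. w \<preceq>\<^sub>J z \<and> z \<preceq>\<^sub>J w}"
  shows "x \<in> J \<Longrightarrow> y \<in> J \<Longrightarrow> 0 < (\<Sum>z\<in>J. coeff (f \<otimes> z) y * coeff (x \<otimes> f) z)"
    and "commuting_on J (\<lambda>y x. coeff (f \<otimes> x) y) (\<lambda>y x. coeff (x \<otimes> f) y)"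
proof -
  have f: "f \<in> carrier R" and supp_f: "supp f = B" by (auto simp: f_def supp_basis_sum)
  have JB: "J \<subseteq> B" using le_J_basis by (auto simp: J)
  have between: "z \<in> J" if "x \<preceq>\<^sub>J z" "z \<preceq>\<^sub>J y" "x \<in> J" "y \<in> J" for x y z
    using that le_J_trans unfolding J by blast
  have lr: "(\<Sum>z\<in>J. coeff (f \<otimes> z) y * coeff (x \<otimes> f) z) = coeff (f \<otimes> x \<otimes> f) y"
    if "x \<in> J" "y \<in> J" for x y
  proof -
    have x: "x \<in> B" and y: "y \<in> B" using that JB by auto
    have "coeff (f \<otimes> x \<otimes> f) y = (\<Sum>z\<in>B. coeff (x \<otimes> f) z * coeff (f \<otimes> z) y)"
      using f x y by (simp add: m_assoc basis_in_carrier coeff_mult_left)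
    also have "\<dots> = (\<Sum>z\<in>J. coeff (x \<otimes> f) z * coeff (f \<otimes> z) y)"
    proof (rule sum.mono_neutral_right[OF finite_basis JB], rule ballI)
      fix z assume z: "z \<in> B - J"
      show "coeff (x \<otimes> f) z * coeff (f \<otimes> z) y = 0"
      proof (rule ccontr)
        assume "coeff (x \<otimes> f) z * coeff (f \<otimes> z) y \<noteq> 0"
        then have "x \<preceq>\<^sub>R z" "z \<preceq>\<^sub>L y"
          using x y z f by (auto intro!: le_RI[of _ f] le_LI[of _ f] simp: supp_def)
        then show False using z between that le_L_imp_le_J le_R_imp_le_J by blast
      qed
    qed
    finally show ?thesis by (simp add: mult.commute)
  qed
  have rl: "(\<Sum>z\<in>J. coeff (z \<otimes> f) y * coeff (f \<otimes> x) z) = coeff (f \<otimes> x \<otimes> f) y"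
    if "x \<in> J" "y \<in> J" for x y
  proof -
    have x: "x \<in> B" and y: "y \<in> B" using that JB by auto
    have "coeff (f \<otimes> x \<otimes> f) y = (\<Sum>z\<in>B. coeff (f \<otimes> x) z * coeff (z \<otimes> f) y)"
      using f x y by (simp add: basis_in_carrier coeff_mult_right[of "f \<otimes> x"])
    also have "\<dots> = (\<Sum>z\<in>J. coeff (f \<otimes> x) z * coeff (z \<otimes> f) y)"
    proof (rule sum.mono_neutral_right[OF finite_basis JB], rule ballI)
      fix z assume z: "z \<in> B - J"
      show "coeff (f \<otimes> x) z * coeff (z \<otimes> f) y = 0"
      proof (rule ccontr)
        assume "coeff (f \<otimes> x) z * coeff (z \<otimes> f) y \<noteq> 0"
        then have "x \<preceq>\<^sub>L z" "z \<preceq>\<^sub>R y"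
          using x y z f by (auto intro!: le_RI[of _ f] le_LI[of _ f] simp: supp_def)
        then show False using z between that le_L_imp_le_J le_R_imp_le_J by blast
      qed
    qed
    finally show ?thesis by (simp add: mult.commute)
  qed
  show "0 < (\<Sum>z\<in>J. coeff (f \<otimes> z) y * coeff (x \<otimes> f) z)" if "x \<in> J" "y \<in> J" for x y
  proof -
    have xB: "x \<in> B" and "x \<preceq>\<^sub>J y" using that JB le_J_trans by (auto simp: J)
    then obtain a a' where a: "a \<in> carrier R" "a' \<in> carrier R" "y \<in> supp (a \<otimes> x \<otimes> a')"
      by (auto simp: le_J_iff)
    moreover have "supp (a \<otimes> x \<otimes> a') \<subseteq> supp (f \<otimes> x \<otimes> f)"
      using a xB f basis_sum_absorbs(1)[OF a(1) xB] supp_subset supp_f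
      by (intro supp_mult_mono) (auto simp: basis_in_carrier f_def)
    ultimately show ?thesis using lr[OF that] by (auto simp: supp_def)
  qed
  show "commuting_on J (\<lambda>y x. coeff (f \<otimes> x) y) (\<lambda>y x. coeff (x \<otimes> f) y)"
    unfolding commuting_on_def by (simp add: lr rl)
qed

lemma le_L_iff_coeff:
  "x \<in> B \<Longrightarrow> y \<in> B \<Longrightarrow> 0 < coeff (basis_sum B \<otimes> x) y \<longleftrightarrow> x \<preceq>\<^sub>L y"
  using basis_sum_absorbs(1) le_LI[OF _ basis_sum_closed]
  unfolding le_L_iff coeff_pos_iff by blast

lemma le_R_iff_coeff:
  "x \<in> B \<Longrightarrow> y \<in> B \<Longrightarrow> 0 < coeff (x \<otimes> basis_sum B) y \<longleftrightarrow> x \<preceq>\<^sub>R y"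
  using basis_sum_absorbs(2) le_RI[OF _ basis_sum_closed]
  unfolding le_R_iff coeff_pos_iff by blast

text \<open>Stability: inside a two-sided cell distinct left cells are incomparable. The preorder is the
  support of left multiplication by the sum of the basis.\<close>

lemma le_L_stable:
  assumes xy: "x \<preceq>\<^sub>L y" and yx: "y \<preceq>\<^sub>J x"
  shows "y \<preceq>\<^sub>L x"
proof -
  define J where "J = {z. x \<preceq>\<^sub>J z \<and> z \<preceq>\<^sub>J x}"
  note matrices = two_sided_class_matrices[OF J_def]
  have JB: "J \<subseteq> B" using le_J_basis by (auto simp: J_def)
  have J: "x \<in> J" "y \<in> J"
    using le_L_basis[OF xy] le_J_refl le_L_imp_le_J[OF xy] yx by (auto simp: J_def)
  show ?thesis
  proof (rule commuting_support_symmetric[where reach = le_L, OF _ matrices(2) _ _ _ _ J xy])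
    show "0 < (\<Sum>z\<in>J. coeff (basis_sum B \<otimes> z) v * coeff (u \<otimes> basis_sum B) z)"
      if "u \<in> J" "v \<in> J" for u v
      by (rule matrices(1)[OF that])
    show "0 < coeff (basis_sum B \<otimes> u) v \<longleftrightarrow> u \<preceq>\<^sub>L v" if "u \<in> J" "v \<in> J" for u v
      using that JB le_L_iff_coeff by blast
    show "finite J" by (rule finite_subset[OF JB finite_basis])
    show "u \<preceq>\<^sub>L u" if "u \<in> J" for u
      using that JB le_L_refl by blast
    show "u \<preceq>\<^sub>L w" if "u \<preceq>\<^sub>L v" "v \<preceq>\<^sub>L w" for u v w
      by (rule le_L_trans[OF that])
  qed
qed

lemma le_R_stable:
  assumes xy: "x \<preceq>\<^sub>R y" and yx: "y \<preceq>\<^sub>J x"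
  shows "y \<preceq>\<^sub>R x"
proof -
  define J where "J = {z. x \<preceq>\<^sub>J z \<and> z \<preceq>\<^sub>J x}"
  note matrices = two_sided_class_matrices[OF J_def]
  have com: "commuting_on J (\<lambda>y x. coeff (x \<otimes> basis_sum B) y) (\<lambda>y x. coeff (basis_sum B \<otimes> x) y)"
    using matrices(2) unfolding commuting_on_def by simp
  have JB: "J \<subseteq> B" using le_J_basis by (auto simp: J_def)
  have J: "x \<in> J" "y \<in> J"
    using le_R_basis[OF xy] le_J_refl le_R_imp_le_J[OF xy] yx by (auto simp: J_def)
  show ?thesis
  proof (rule commuting_support_symmetric[where reach = le_R, OF _ com _ _ _ _ J xy])
    show "0 < (\<Sum>z\<in>J. coeff (z \<otimes> basis_sum B) v * coeff (basis_sum B \<otimes> u) z)"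
      if "u \<in> J" "v \<in> J" for u v
      using matrices(1)[OF that] com that unfolding commuting_on_def by simp
    show "0 < coeff (u \<otimes> basis_sum B) v \<longleftrightarrow> u \<preceq>\<^sub>R v" if "u \<in> J" "v \<in> J" for u v
      using that JB le_R_iff_coeff by blast
    show "finite J" by (rule finite_subset[OF JB finite_basis])
    show "u \<preceq>\<^sub>R u" if "u \<in> J" for u
      using that JB le_R_refl by blast
    show "u \<preceq>\<^sub>R w" if "u \<preceq>\<^sub>R v" "v \<preceq>\<^sub>R w" for u v w
      by (rule le_R_trans[OF that])
  qed
qed


lemma left_cells_iff: "L \<in> left_cells R B \<longleftrightarrow> (\<exists>x\<in>B. L = {z. x \<preceq>\<^sub>L z \<and> z \<preceq>\<^sub>L x})"
  and right_cells_iff: "L \<in> right_cells R B \<longleftrightarrow> (\<exists>x\<in>B. L = {z. x \<preceq>\<^sub>R z \<and> z \<preceq>\<^sub>R x})"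
  and two_sided_cells_iff: "L \<in> two_sided_cells R B \<longleftrightarrow> (\<exists>x\<in>B. L = {z. x \<preceq>\<^sub>J z \<and> z \<preceq>\<^sub>J x})"
  by (auto simp: left_cells_def right_cells_def two_sided_cells_def quotient_def
      le_L_def le_R_def le_J_def Image_def)

definition H_class :: "'a \<Rightarrow> 'a set" where
  "H_class x = {z. x \<preceq>\<^sub>L z \<and> z \<preceq>\<^sub>L x \<and> x \<preceq>\<^sub>R z \<and> z \<preceq>\<^sub>R x}"

lemma H_class_self: "x \<in> B \<Longrightarrow> x \<in> H_class x"
  by (simp add: H_class_def le_L_refl le_R_refl)

lemma H_class_eq: "y \<in> H_class x \<Longrightarrow> H_class y = H_class x"
  unfolding H_class_def using le_L_trans le_R_trans by blast

lemma left_cell_subset: "L \<in> left_cells R B \<Longrightarrow> L \<subseteq> B"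
  using le_L_basis by (auto simp: left_cells_iff)

lemma left_cell_mem_iff:
  "L \<in> left_cells R B \<Longrightarrow> x \<in> L \<Longrightarrow> y \<in> L \<longleftrightarrow> x \<preceq>\<^sub>L y \<and> y \<preceq>\<^sub>L x"
  unfolding left_cells_iff using le_L_trans by blast

lemma right_cell_mem_iff:
  "K \<in> right_cells R B \<Longrightarrow> x \<in> K \<Longrightarrow> y \<in> K \<longleftrightarrow> x \<preceq>\<^sub>R y \<and> y \<preceq>\<^sub>R x"
  unfolding right_cells_iff using le_R_trans by blast

text \<open>An H-cell is determined by any of its elements, and every element of \<open>L\<close> has its H-cell inside
  \<open>L\<close>.\<close>

lemma H_cells_in_eq:
  assumes L: "L \<in> left_cells R B"
  shows "H_cells_in R B L = H_class ` L"
proof (intro subset_antisym subsetI)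
  fix H assume "H \<in> H_cells_in R B L"
  then obtain K K' h where K: "K \<in> left_cells R B" "K' \<in> right_cells R B" "H = K \<inter> K'"
    and h: "h \<in> H" and HL: "H \<subseteq> L"
    by (auto simp: H_cells_in_def H_cells_def)
  have "h \<in> K" "h \<in> K'" using h K(3) by auto
  then have "H = H_class h"
    using left_cell_mem_iff[OF K(1)] right_cell_mem_iff[OF K(2)] K(3) by (auto simp: H_class_def)
  then show "H \<in> H_class ` L" using h HL by blast
next
  fix H assume "H \<in> H_class ` L"
  then obtain h where h: "h \<in> L" "H = H_class h" by blast
  then have hB: "h \<in> B" using left_cell_subset[OF L] by auto
  have "H = {z. h \<preceq>\<^sub>L z \<and> z \<preceq>\<^sub>L h} \<inter> {z. h \<preceq>\<^sub>R z \<and> z \<preceq>\<^sub>R h}"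
    using h by (auto simp: H_class_def)
  then have "H \<in> H_cells R B"
    using hB unfolding H_cells_def by (auto simp: left_cells_iff right_cells_iff)
  moreover have "H \<subseteq> L"
    using left_cell_mem_iff[OF L h(1)] by (auto simp: h(2) H_class_def)
  ultimately show "H \<in> H_cells_in R B L"
    using H_class_self[OF hB] h(2) by (auto simp: H_cells_in_def)
qed

text \<open>Another representative is \<open>x'\<close> with \<open>x\<close> in the support of \<open>x' c\<close>. Then \<open>y\<close> occurs in \<open>a x' c\<close>,
  hence in \<open>y' c\<close> for some \<open>y'\<close> in the support of \<open>a x'\<close>. All these elements are in one two-sided
  cell, so stability turns \<open>y' \<preceq>\<^sub>R y\<close> into right equivalence and \<open>x' \<preceq>\<^sub>L y'\<close> into left
  equivalence.\<close>

lemma H_class_action_independent: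
  assumes x: "x \<in> B" and x': "x' \<in> H_class x" and a: "a \<in> carrier R"
    and y: "y \<in> supp (a \<otimes> x)" and yx: "y \<preceq>\<^sub>L x"
  shows "\<exists>y'\<in>H_class y. y' \<in> supp (a \<otimes> x')"
proof -
  have x'B: "x' \<in> B" and "x' \<preceq>\<^sub>R x" using x' le_L_basis by (auto simp: H_class_def)
  then obtain c where c: "c \<in> carrier R" "x \<in> supp (x' \<otimes> c)" by (auto simp: le_R_iff)
  have "y \<in> supp (a \<otimes> (x' \<otimes> c))"
    using c a x'B y by (subst supp_mult_left) (auto simp: basis_in_carrier)
  then obtain y' where y': "y' \<in> supp (a \<otimes> x')" "y \<in> supp (y' \<otimes> c)"
    using a c x'B supp_mult_right[of "a \<otimes> x'" c] by (auto simp: m_assoc basis_in_carrier)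
  have y'B: "y' \<in> B" using y' supp_subset by auto
  have xy: "x \<preceq>\<^sub>L y" and x'y': "x' \<preceq>\<^sub>L y'" and y'y: "y' \<preceq>\<^sub>R y"
    using x x'B y'B a c y y' by (auto intro: le_LI le_RI)
  have xx': "x \<preceq>\<^sub>L x'" "x' \<preceq>\<^sub>L x" using x' by (auto simp: H_class_def)
  have "y' \<preceq>\<^sub>J x'"
    by (rule le_J_trans[OF le_R_imp_le_J[OF y'y] le_L_imp_le_J[OF le_L_trans[OF yx xx'(1)]]])
  moreover have "y \<preceq>\<^sub>J y'"
    by (rule le_L_imp_le_J[OF le_L_trans[OF yx le_L_trans[OF xx'(1) x'y']]])
  ultimately have y'x': "y' \<preceq>\<^sub>L x'" and yy': "y \<preceq>\<^sub>R y'"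
    using le_L_stable[OF x'y'] le_R_stable[OF y'y] by auto
  have "y' \<preceq>\<^sub>L y" by (rule le_L_trans[OF y'x' le_L_trans[OF xx'(2) xy]])
  moreover have "y \<preceq>\<^sub>L y'" by (rule le_L_trans[OF yx le_L_trans[OF xx'(1) x'y']])
  ultimately have "y' \<in> H_class y" using y'y yy' by (simp add: H_class_def)
  then show ?thesis using y' by auto
qed

section \<open>Reduced cell semimodules\<close>

lemma reduced_smult_mem_iff:
  assumes L: "L \<in> left_cells R B" and X: "X \<subseteq> H_cells_in R B L" and a: "a \<in> carrier R"
  shows "K \<in> a \<odot>\<^bsub>reduced_cell_semimodule R B L\<^esub> X \<longleftrightarrow>
    K \<in> H_cells_in R B L \<and> (\<exists>x\<in>\<Union>X. \<exists>y\<in>K. y \<in> supp (a \<otimes> x))"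
proof -
  have XB: "\<And>H x. H \<in> X \<Longrightarrow> x \<in> H \<Longrightarrow> x \<in> B"
    using X left_cell_subset[OF L] unfolding H_cells_in_def by blast
  have KB: "\<And>y. K \<in> H_cells_in R B L \<Longrightarrow> y \<in> K \<Longrightarrow> y \<in> B"
    using left_cell_subset[OF L] unfolding H_cells_in_def by blast
  have "K \<in> a \<odot>\<^bsub>reduced_cell_semimodule R B L\<^esub> X \<longleftrightarrow>
      K \<in> H_cells_in R B L \<and> (\<exists>H\<in>X. \<exists>x\<in>H. \<exists>y\<in>K. \<exists>b\<in>supp a. coeff (b \<otimes> x) y \<noteq> 0)"
    unfolding reduced_cell_semimodule_def H_action_def by (auto simp: supp_def)
  moreover have "(\<exists>b\<in>supp a. coeff (b \<otimes> x) y \<noteq> 0) \<longleftrightarrow> y \<in> supp (a \<otimes> x)"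
    if "K \<in> H_cells_in R B L" "H \<in> X" "x \<in> H" "y \<in> K" for H x y
    unfolding supp_mult_right[OF a basis_in_carrier[OF XB[OF that(2,3)]]]
    using KB[OF that(1,4)] by (auto simp: supp_def)
  ultimately show ?thesis by blast
qed

lemma reduced_cell_semimodule_carrier:
  "carrier (reduced_cell_semimodule R B L) = Pow (H_cells_in R B L)"
  and reduced_cell_semimodule_zero: "\<zero>\<^bsub>reduced_cell_semimodule R B L\<^esub> = {}"
  and reduced_cell_semimodule_add: "X \<oplus>\<^bsub>reduced_cell_semimodule R B L\<^esub> Y = X \<union> Y"
  by (simp_all add: reduced_cell_semimodule_def)

lemma H_class_mem_reduced_smult_iff:
  assumes L: "L \<in> left_cells R B" and X: "X \<subseteq> H_cells_in R B L" and a: "a \<in> carrier R"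
    and y: "y \<in> L"
  shows "H_class y \<in> a \<odot>\<^bsub>reduced_cell_semimodule R B L\<^esub> X \<longleftrightarrow>
    (\<exists>x\<in>\<Union>X. \<exists>y'\<in>H_class y. y' \<in> supp (a \<otimes> x))"
  using reduced_smult_mem_iff[OF L X a] y by (auto simp: H_cells_in_eq[OF L])

text \<open>Only associativity is not formal. An intermediate basis element between two elements of \<open>L\<close>
  lies in \<open>L\<close>, which gives one inclusion; the other has to continue a step into an H-cell from a
  different representative of that cell, which independence of representatives allows.\<close>

lemma semimodule_reduced_cell_semimodule:
  assumes L: "L \<in> left_cells R B"
  shows "semimodule R (reduced_cell_semimodule R B L)" (is "semimodule R ?C")
proof -
  note simps = reduced_cell_semimodule_carrier reduced_cell_semimodule_zero
    reduced_cell_semimodule_add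
  note mem = reduced_smult_mem_iff[OF L]
  have LB: "L \<subseteq> B" by (rule left_cell_subset[OF L])
  have XL: "x \<in> L" if "X \<subseteq> H_cells_in R B L" "x \<in> \<Union>X" for x X
    using that unfolding H_cells_in_def by blast
  show ?thesis
  proof (intro semimodule.intro semimodule_axioms.intro)
    show "semiring R" by (rule semiring_axioms)
    show "abelian_monoid ?C"
      by (rule abelian_monoidI) (auto simp: simps)
    show "a \<odot>\<^bsub>?C\<^esub> X \<in> carrier ?C" if "a \<in> carrier R" "X \<in> carrier ?C" for a X
      using mem that by (auto simp: simps)
    show "a \<odot>\<^bsub>?C\<^esub> \<zero>\<^bsub>?C\<^esub> = \<zero>\<^bsub>?C\<^esub>" if "a \<in> carrier R" for a
      using mem[OF _ that, of "{}"] by (auto simp: simps)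
    show "a \<odot>\<^bsub>?C\<^esub> (X \<oplus>\<^bsub>?C\<^esub> Y) = a \<odot>\<^bsub>?C\<^esub> X \<oplus>\<^bsub>?C\<^esub> a \<odot>\<^bsub>?C\<^esub> Y"
      if "a \<in> carrier R" "X \<in> carrier ?C" "Y \<in> carrier ?C" for a X Y
    proof (rule Set.set_eqI)
      fix K
      show "K \<in> a \<odot>\<^bsub>?C\<^esub> (X \<oplus>\<^bsub>?C\<^esub> Y)
          \<longleftrightarrow> K \<in> a \<odot>\<^bsub>?C\<^esub> X \<oplus>\<^bsub>?C\<^esub> a \<odot>\<^bsub>?C\<^esub> Y"
        using that mem[of X a K] mem[of Y a K] mem[of "X \<union> Y" a K]
        unfolding simps Pow_iff Union_Un_distrib bex_Un by blast
    qed
    fix X assume X: "X \<in> carrier ?C"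
    then have XH: "X \<subseteq> H_cells_in R B L" by (simp add: simps)
    note mem_zero = mem[OF XH zero_closed] and mem_one = mem[OF XH one_closed]
    show "\<zero> \<odot>\<^bsub>?C\<^esub> X = \<zero>\<^bsub>?C\<^esub>"
    proof -
      have "supp (\<zero> \<otimes> x) = {}" if "x \<in> \<Union>X" for x
        using XL[OF XH that] LB basis_in_carrier by (auto simp: supp_zero)
      then show ?thesis using mem_zero by (auto simp: simps)
    qed
    show "\<one> \<odot>\<^bsub>?C\<^esub> X = X"
    proof (rule Set.set_eqI)
      fix K
      show "K \<in> \<one> \<odot>\<^bsub>?C\<^esub> X \<longleftrightarrow> K \<in> X"
      proof
        assume "K \<in> \<one> \<odot>\<^bsub>?C\<^esub> X"
        then obtain x y H where K: "K \<in> H_cells_in R B L"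
            and *: "x \<in> H" "H \<in> X" "y \<in> K" "y \<in> supp (\<one> \<otimes> x)"
          using mem_one by auto
        then have "x \<in> B" using XL[OF XH, of x] LB by blast
        then have "x = y" using *(4) by (simp add: basis_in_carrier supp_basis)
        moreover have "H = H_class x" "K = H_class y"
          using * K XH H_class_eq unfolding H_cells_in_eq[OF L] by blast+
        ultimately show "K \<in> X" using * by simp
      next
        assume KX: "K \<in> X"
        then obtain x where x: "x \<in> L" "K = H_class x" using XH by (auto simp: H_cells_in_eq[OF L])
        then have "x \<in> K" "x \<in> supp (\<one> \<otimes> x)"
          using LB H_class_self by (auto simp: basis_in_carrier supp_basis subset_iff)
        then show "K \<in> \<one> \<odot>\<^bsub>?C\<^esub> X"
          using mem_one KX XH by blast
      qed
    qed
    fix a b assume a: "a \<in> carrier R" and b: "b \<in> carrier R"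
    show "(a \<oplus> b) \<odot>\<^bsub>?C\<^esub> X = a \<odot>\<^bsub>?C\<^esub> X \<oplus>\<^bsub>?C\<^esub> b \<odot>\<^bsub>?C\<^esub> X"
    proof (rule Set.set_eqI)
      fix K
      have "y \<in> supp ((a \<oplus> b) \<otimes> x) \<longleftrightarrow> y \<in> supp (a \<otimes> x) \<or> y \<in> supp (b \<otimes> x)"
        if "x \<in> \<Union>X" for x y
        using subsetD[OF LB XL[OF XH that]] a b by (simp add: l_distr supp_add basis_in_carrier)
      then show "K \<in> (a \<oplus> b) \<odot>\<^bsub>?C\<^esub> X \<longleftrightarrow> K \<in> a \<odot>\<^bsub>?C\<^esub> X \<oplus>\<^bsub>?C\<^esub> b \<odot>\<^bsub>?C\<^esub> X"
        using mem[OF XH a, of K] mem[OF XH b, of K] mem[OF XH a_closed[OF a b], of K]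
        unfolding simps Un_iff by blast
    qed
    have bX: "b \<odot>\<^bsub>?C\<^esub> X \<subseteq> H_cells_in R B L"
      using mem[OF XH b] by auto
    show "(a \<otimes> b) \<odot>\<^bsub>?C\<^esub> X = a \<odot>\<^bsub>?C\<^esub> (b \<odot>\<^bsub>?C\<^esub> X)"
    proof (rule Set.set_eqI)
      fix K
      show "K \<in> (a \<otimes> b) \<odot>\<^bsub>?C\<^esub> X \<longleftrightarrow> K \<in> a \<odot>\<^bsub>?C\<^esub> (b \<odot>\<^bsub>?C\<^esub> X)"
      proof
        assume "K \<in> (a \<otimes> b) \<odot>\<^bsub>?C\<^esub> X"
        then obtain x y where K: "K \<in> H_cells_in R B L"
          and *: "x \<in> \<Union>X" "y \<in> K" "y \<in> supp (a \<otimes> b \<otimes> x)"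
          using mem[OF XH m_closed[OF a b]] by auto
        have x: "x \<in> L" "x \<in> B" using XL[OF XH *(1)] LB by auto
        have y: "y \<in> L" using K * by (auto simp: H_cells_in_def)
        obtain z where z: "z \<in> supp (b \<otimes> x)" "y \<in> supp (a \<otimes> z)"
          using * a b x supp_mult_left[of a "b \<otimes> x"] by (auto simp: m_assoc basis_in_carrier)
        have "x \<preceq>\<^sub>L z" "z \<preceq>\<^sub>L y"
          using z x a b supp_subset by (auto intro: le_LI)
        then have zL: "z \<in> L"
          using left_cell_mem_iff[OF L] x y le_L_trans by blast
        then have zz: "z \<in> H_class z" using LB H_class_self by auto
        then have "H_class z \<in> b \<odot>\<^bsub>?C\<^esub> X"
          using H_class_mem_reduced_smult_iff[OF L XH b zL] * z by blast
        then show "K \<in> a \<odot>\<^bsub>?C\<^esub> (b \<odot>\<^bsub>?C\<^esub> X)"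
          using mem[OF bX a] K *(2) z zz by blast
      next
        assume "K \<in> a \<odot>\<^bsub>?C\<^esub> (b \<odot>\<^bsub>?C\<^esub> X)"
        then obtain z y H where K: "K \<in> H_cells_in R B L"
          and *: "z \<in> H" "H \<in> b \<odot>\<^bsub>?C\<^esub> X" "y \<in> K" "y \<in> supp (a \<otimes> z)"
          using mem[OF bX a] by auto
        then obtain x z' where **: "x \<in> \<Union>X" "z' \<in> H" "z' \<in> supp (b \<otimes> x)"
          and H: "H \<in> H_cells_in R B L"
          using mem[OF XH b] by auto
        have zz': "H = H_class z" "H = H_class z'"
          using H *(1) **(2) H_class_eq unfolding H_cells_in_eq[OF L] by blast+
        have zL: "z \<in> L" and yL: "y \<in> L"
          using H K * by (auto simp: H_cells_in_def)
        then have yz: "y \<preceq>\<^sub>L z" and zB: "z \<in> B" using left_cell_mem_iff[OF L] LB by auto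
        obtain y' where y': "y' \<in> H_class y" "y' \<in> supp (a \<otimes> z')"
          using H_class_action_independent[OF zB _ a *(4) yz] zz' **(2) by auto
        have x: "x \<in> B" using XL[OF XH **(1)] LB by auto
        have "y' \<in> supp (a \<otimes> b \<otimes> x)"
          using a b x **(3) y'(2) supp_mult_left[of a "b \<otimes> x"]
          by (auto simp: m_assoc basis_in_carrier)
        moreover have "K = H_class y"
          using K *(3) H_class_eq unfolding H_cells_in_eq[OF L] by blast
        ultimately show "K \<in> (a \<otimes> b) \<odot>\<^bsub>?C\<^esub> X"
          using mem[OF XH m_closed[OF a b]] K **(1) y'(1) by auto
      qed
    qed
  qed
qed

text \<open>Idempotency only provides some product \<open>p q\<close> that stays in the cell. Writing \<open>q\<close> as a constituent
  of \<open>c x d\<close> moves this to a product \<open>w x\<close> with the prescribed right factor.\<close>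

lemma idempotent_cell_left_mult:
  assumes idem: "\<forall>J\<in>two_sided_cells R B. idempotent_cell R B J" and x: "x \<in> B"
  shows "\<exists>w. w \<preceq>\<^sub>J x \<and> x \<preceq>\<^sub>J w \<and> (\<exists>z. z \<in> supp (w \<otimes> x) \<and> z \<preceq>\<^sub>J x)"
proof -
  let ?J = "{z. x \<preceq>\<^sub>J z \<and> z \<preceq>\<^sub>J x}"
  have "?J \<in> two_sided_cells R B"
    unfolding two_sided_cells_iff by (rule bexI[OF refl x])
  then have "idempotent_cell R B ?J" using idem by blast
  then obtain p q r where J: "p \<in> ?J" "q \<in> ?J" "r \<in> ?J" and r: "coeff (p \<otimes> q) r \<noteq> 0"
    unfolding idempotent_cell_def by blast
  then have B: "p \<in> B" "q \<in> B" "r \<in> B" using le_J_basis by auto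
  obtain c d where cd: "c \<in> carrier R" "d \<in> carrier R" "q \<in> supp (c \<otimes> x \<otimes> d)"
    using J(2) by (auto simp: le_J_iff)
  have "r \<in> supp (p \<otimes> (c \<otimes> x \<otimes> d))"
    using cd B r x by (subst supp_mult_left) (auto simp: supp_def basis_in_carrier)
  also have "p \<otimes> (c \<otimes> x \<otimes> d) = (p \<otimes> c) \<otimes> x \<otimes> d"
    using cd B x by (simp add: m_assoc basis_in_carrier)
  finally obtain z where z: "z \<in> supp ((p \<otimes> c) \<otimes> x)" "r \<in> supp (z \<otimes> d)"
    using cd B x supp_mult_right[of "(p \<otimes> c) \<otimes> x" d] by (auto simp: basis_in_carrier)
  then obtain w where w: "w \<in> supp (p \<otimes> c)" "z \<in> supp (w \<otimes> x)"
    using cd B x supp_mult_right[of "p \<otimes> c" x] by (auto simp: basis_in_carrier)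
  have wB: "w \<in> B" and zB: "z \<in> B" using w z supp_subset by auto
  have "p \<preceq>\<^sub>R w" "w \<preceq>\<^sub>R z" "z \<preceq>\<^sub>R r"
    using le_RI[OF B(1) cd(1) w(1)] le_RI[OF wB basis_in_carrier[OF x] w(2)] le_RI[OF zB cd(2) z(2)]
    by auto
  then have "p \<preceq>\<^sub>J w" "w \<preceq>\<^sub>J z" "z \<preceq>\<^sub>J r" using le_R_imp_le_J by auto
  then show ?thesis using J w(2) le_J_trans by blast
qed

text \<open>A basis element \<open>v\<close> in the right cell of \<open>K\<close> can send H-cells of \<open>L\<close> only to \<open>K\<close>: what occurs in
  \<open>v x'\<close> lies above \<open>v\<close> for the right preorder, hence by stability in the right cell of \<open>v\<close> as soon
  as it lies in \<open>L\<close>. Idempotency provides such a \<open>v\<close> that does not annihilate \<open>X\<close>.\<close>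

lemma reduced_cell_reach_singleton:
  assumes idem: "\<forall>J\<in>two_sided_cells R B. idempotent_cell R B J"
    and L: "L \<in> left_cells R B" and X: "X \<subseteq> H_cells_in R B L" "X \<noteq> {}"
    and K: "K \<in> H_cells_in R B L"
  shows "\<exists>a\<in>carrier R. a \<odot>\<^bsub>reduced_cell_semimodule R B L\<^esub> X = {K}"
proof -
  have LB: "L \<subseteq> B" by (rule left_cell_subset[OF L])
  obtain x where x: "x \<in> L" "x \<in> \<Union>X"
    using X H_class_self LB unfolding H_cells_in_eq[OF L] by blast
  obtain y where y: "y \<in> L" "K = H_class y" using K by (auto simp: H_cells_in_eq[OF L])
  have xB: "x \<in> B" and yB: "y \<in> B" using x y LB by auto
  obtain w z where w: "w \<preceq>\<^sub>J x" "x \<preceq>\<^sub>J w" and z: "z \<in> supp (w \<otimes> x)" "z \<preceq>\<^sub>J x"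
    using idempotent_cell_left_mult[OF idem xB] by blast
  have wB: "w \<in> B" and zB: "z \<in> B" using w z le_J_basis by auto
  have xz: "x \<preceq>\<^sub>L z" using z(1) wB xB by (auto intro: le_LI basis_in_carrier)
  then have "z \<preceq>\<^sub>L x" using z(2) le_L_stable by blast
  then have "z \<preceq>\<^sub>L y" using x y left_cell_mem_iff[OF L] le_L_trans by blast
  then obtain b where b: "b \<in> carrier R" "y \<in> supp (b \<otimes> z)" by (auto simp: le_L_iff)
  then have "y \<in> supp (b \<otimes> (w \<otimes> x))"
    using wB xB z(1) by (subst supp_mult_left) (auto simp: basis_in_carrier)
  then obtain v where v: "v \<in> supp (b \<otimes> w)" "y \<in> supp (v \<otimes> x)"
    using b wB xB supp_mult_right[of "b \<otimes> w" x] by (auto simp: basis_in_carrier m_assoc)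
  have vB: "v \<in> B" using v supp_subset by auto
  then have vR: "v \<in> carrier R" by (rule basis_in_carrier)
  have "w \<preceq>\<^sub>L v" "v \<preceq>\<^sub>R y"
    using v b wB xB vB by (auto intro: le_LI le_RI basis_in_carrier)
  moreover have xy: "x \<preceq>\<^sub>L y" "y \<preceq>\<^sub>L x" using x y left_cell_mem_iff[OF L] by auto
  ultimately have vy: "v \<preceq>\<^sub>R y" "y \<preceq>\<^sub>J v"
    using w le_L_imp_le_J le_J_trans by blast+
  then have yv: "y \<preceq>\<^sub>R v" using le_R_stable by blast
  have "v \<odot>\<^bsub>reduced_cell_semimodule R B L\<^esub> X = {K}"
  proof (intro subset_antisym subsetI)
    fix H assume "H \<in> {K}"
    then show "H \<in> v \<odot>\<^bsub>reduced_cell_semimodule R B L\<^esub> X"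
      using reduced_smult_mem_iff[OF L X(1) vR, of K] K v(2) x(2) y(2) H_class_self[OF yB] by auto
  next
    fix H assume "H \<in> v \<odot>\<^bsub>reduced_cell_semimodule R B L\<^esub> X"
    then obtain x' y' where *: "x' \<in> \<Union>X" "y' \<in> H" "y' \<in> supp (v \<otimes> x')" and H: "H \<in> H_cells_in R B L"
      using reduced_smult_mem_iff[OF L X(1) vR] by auto
    have y'L: "y' \<in> L" using H * by (auto simp: H_cells_in_def)
    have "x' \<in> B" using * X(1) LB by (auto simp: H_cells_in_def)
    then have vy': "v \<preceq>\<^sub>R y'" using * vB by (auto intro: le_RI basis_in_carrier)
    have yy': "y' \<preceq>\<^sub>L y" "y \<preceq>\<^sub>L y'" using y'L y left_cell_mem_iff[OF L] by auto
    then have "y' \<preceq>\<^sub>R v" using le_R_stable[OF vy'] vy yv le_L_imp_le_J le_R_imp_le_J le_J_trans by blast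
    then have "y' \<in> H_class y"
      using yy' vy' vy yv le_R_trans unfolding H_class_def by blast
    moreover have "H = H_class y'" using H *(2) H_class_eq unfolding H_cells_in_eq[OF L] by blast
    ultimately show "H \<in> {K}" using y(2) H_class_eq by auto
  qed
  then show ?thesis using vR by blast
qed

lemma minimal_reduced_cell_semimodule:
  assumes idem: "\<forall>J\<in>two_sided_cells R B. idempotent_cell R B J" and L: "L \<in> left_cells R B"
  shows "minimal_semimodule R (reduced_cell_semimodule R B L)" (is "minimal_semimodule R ?C")
  unfolding minimal_semimodule_def
proof (intro conjI allI impI)
  note simps = reduced_cell_semimodule_carrier reduced_cell_semimodule_zero reduced_cell_semimodule_add
  show "semimodule R ?C" by (rule semimodule_reduced_cell_semimodule[OF L])
  have "L \<noteq> {}" using L le_L_refl unfolding left_cells_iff by blast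
  then show "carrier ?C \<noteq> {\<zero>\<^bsub>?C\<^esub>}" by (auto simp: simps H_cells_in_eq[OF L])
  fix N assume N: "subsemimodule N R ?C"
  then have sub: "N \<subseteq> carrier ?C" and N_zero: "\<zero>\<^bsub>?C\<^esub> \<in> N"
    and N_add: "\<And>X Y. X \<in> N \<Longrightarrow> Y \<in> N \<Longrightarrow> X \<oplus>\<^bsub>?C\<^esub> Y \<in> N"
    and N_smult: "\<And>a X. a \<in> carrier R \<Longrightarrow> X \<in> N \<Longrightarrow> a \<odot>\<^bsub>?C\<^esub> X \<in> N"
    using subsemimoduleD[OF N] by blast+
  show "N = {\<zero>\<^bsub>?C\<^esub>} \<or> N = carrier ?C"
  proof (cases "N \<subseteq> {{}}")
    case True
    then show ?thesis using N_zero by (auto simp: simps)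
  next
    case False
    then obtain X where X: "X \<in> N" "X \<noteq> {}" by blast
    have XH: "X \<subseteq> H_cells_in R B L" using X sub by (auto simp: simps)
    have single: "{K} \<in> N" if "K \<in> H_cells_in R B L" for K
      using reduced_cell_reach_singleton[OF idem L XH X(2) that] N_smult X(1) by metis
    have fin: "finite (H_cells_in R B L)"
      using left_cell_subset[OF L] finite_basis finite_subset unfolding H_cells_in_eq[OF L] by blast
    have "Y \<in> N" if "Y \<subseteq> H_cells_in R B L" for Y
      using finite_subset[OF that fin] that
    proof (induction Y rule: finite_induct)
      case empty
      show ?case using N_zero by (simp add: simps)
    next
      case (insert K Y)
      then show ?case using N_add[OF single[of K], of Y] by (simp add: simps)
    qed
    then show ?thesis using sub by (auto simp: simps)
  qed
qed

end

section \<open>Minimal proper semimodules\<close>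

lemma finite_transp_maximal:
  assumes "finite A" "A \<noteq> {}"
    and trans: "\<And>x y z. x \<in> A \<Longrightarrow> y \<in> A \<Longrightarrow> z \<in> A \<Longrightarrow> r x y \<Longrightarrow> r y z \<Longrightarrow> r x z"
  shows "\<exists>x\<in>A. \<forall>y\<in>A. r x y \<longrightarrow> r y x"
proof -
  let ?s = "\<lambda>x y. r x y \<and> \<not> r y x"
  have "\<exists>x\<in>A. \<forall>y\<in>A. y \<noteq> x \<longrightarrow> \<not> ?s x y"
    by (rule Finite_Set.bex_max_element[OF assms(1) _ _ assms(2)])
      (auto intro!: asymp_onI transp_onI dest: trans intro: trans)
  then obtain x where "x \<in> A" and max: "\<forall>y\<in>A. y \<noteq> x \<longrightarrow> \<not> ?s x y" ..
  moreover have "r y x" if "y \<in> A" "r x y" for y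
    using max that by (cases "y = x") auto
  ultimately show ?thesis by blast
qed

locale minimal_proper_semimodule = semimodule R M + R?: fg_nat_semiring R B
  for R (structure) and M :: "('a, 'm, 'y) module_scheme" (structure) and B +
  assumes minimal: "minimal_semimodule R M" and proper: "proper_semimodule R M"
begin

lemma subsemimodule_trivial:
  assumes "N \<subseteq> carrier M" "\<zero>\<^bsub>M\<^esub> \<in> N"
    and "\<And>x y. x \<in> N \<Longrightarrow> y \<in> N \<Longrightarrow> x \<oplus>\<^bsub>M\<^esub> y \<in> N"
    and "\<And>a x. a \<in> carrier R \<Longrightarrow> x \<in> N \<Longrightarrow> a \<odot>\<^bsub>M\<^esub> x \<in> N"
  shows "N = {\<zero>\<^bsub>M\<^esub>} \<or> N = carrier M"
proof -
  have "subsemimodule N R M"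
    using assms by (simp add: subsemimodule_def submonoid_def)
  then show ?thesis using minimal unfolding minimal_semimodule_def by blast
qed

lemma nonzero_generates:
  assumes N: "N \<subseteq> carrier M" "\<zero>\<^bsub>M\<^esub> \<in> N"
    and "\<And>x y. x \<in> N \<Longrightarrow> y \<in> N \<Longrightarrow> x \<oplus>\<^bsub>M\<^esub> y \<in> N"
    and "\<And>a x. a \<in> carrier R \<Longrightarrow> x \<in> N \<Longrightarrow> a \<odot>\<^bsub>M\<^esub> x \<in> N"
    and e: "e \<in> N" "e \<noteq> \<zero>\<^bsub>M\<^esub>"
  shows "N = carrier M"
  using subsemimodule_trivial[of N] assms by blast

lemma add_add_swap:
  assumes "u \<in> carrier M" "v \<in> carrier M" "x \<in> carrier M" "y \<in> carrier M"
  shows "(u \<oplus>\<^bsub>M\<^esub> v) \<oplus>\<^bsub>M\<^esub> (x \<oplus>\<^bsub>M\<^esub> y) = (u \<oplus>\<^bsub>M\<^esub> x) \<oplus>\<^bsub>M\<^esub> (v \<oplus>\<^bsub>M\<^esub> y)"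
  using assms by (simp add: M.a_ac)

text \<open>The invertible elements form a subsemimodule. If it were everything, \<open>M\<close> would be a group.\<close>

lemma zerosumfree:
  assumes x: "x \<in> carrier M" "y \<in> carrier M" "x \<oplus>\<^bsub>M\<^esub> y = \<zero>\<^bsub>M\<^esub>"
  shows "x = \<zero>\<^bsub>M\<^esub>"
proof -
  let ?N = "{x \<in> carrier M. \<exists>y\<in>carrier M. y \<oplus>\<^bsub>M\<^esub> x = \<zero>\<^bsub>M\<^esub>}"
  have "?N = {\<zero>\<^bsub>M\<^esub>} \<or> ?N = carrier M"
  proof (rule subsemimodule_trivial)
    show "x \<oplus>\<^bsub>M\<^esub> y \<in> ?N" if xy: "x \<in> ?N" "y \<in> ?N" for x y
    proof -
      obtain x' y' where *: "x' \<in> carrier M" "x' \<oplus>\<^bsub>M\<^esub> x = \<zero>\<^bsub>M\<^esub>"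
        "y' \<in> carrier M" "y' \<oplus>\<^bsub>M\<^esub> y = \<zero>\<^bsub>M\<^esub>" "x \<in> carrier M" "y \<in> carrier M"
        using xy by blast
      have "(x' \<oplus>\<^bsub>M\<^esub> y') \<oplus>\<^bsub>M\<^esub> (x \<oplus>\<^bsub>M\<^esub> y) = (x' \<oplus>\<^bsub>M\<^esub> x) \<oplus>\<^bsub>M\<^esub> (y' \<oplus>\<^bsub>M\<^esub> y)"
        by (rule add_add_swap) (use * in auto)
      then have "(x' \<oplus>\<^bsub>M\<^esub> y') \<oplus>\<^bsub>M\<^esub> (x \<oplus>\<^bsub>M\<^esub> y) = \<zero>\<^bsub>M\<^esub>" using * by simp
      then show ?thesis using * M.a_closed by blast
    qed
    show "a \<odot>\<^bsub>M\<^esub> x \<in> ?N" if a: "a \<in> carrier R" and x: "x \<in> ?N" for a x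
    proof -
      obtain x' where "x' \<in> carrier M" "x' \<oplus>\<^bsub>M\<^esub> x = \<zero>\<^bsub>M\<^esub>" "x \<in> carrier M" using x by blast
      then have "a \<odot>\<^bsub>M\<^esub> x' \<oplus>\<^bsub>M\<^esub> a \<odot>\<^bsub>M\<^esub> x = \<zero>\<^bsub>M\<^esub>"
        using a by (simp add: smult_zero flip: smult_r_distr)
      then show ?thesis using a x \<open>x' \<in> carrier M\<close> smult_closed by blast
    qed
  qed auto
  moreover have "?N \<noteq> carrier M"
  proof
    assume N: "?N = carrier M"
    have "\<exists>y\<in>carrier M. y \<oplus>\<^bsub>M\<^esub> x = \<zero>\<^bsub>M\<^esub>" if "x \<in> carrier M" for x
      using that N by blast
    then have "abelian_group M"
      by (intro abelian_groupI) (simp_all add: M.a_ac)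
    then show False using proper unfolding proper_semimodule_def by blast
  qed
  ultimately have "?N = {\<zero>\<^bsub>M\<^esub>}" by blast
  moreover have "x \<in> ?N" using x M.a_comm[of x y] by auto
  ultimately show ?thesis by blast
qed

lemma cyclic:
  assumes m: "m \<in> carrier M" "m \<noteq> \<zero>\<^bsub>M\<^esub>" and n: "n \<in> carrier M"
  shows "\<exists>a\<in>carrier R. n = a \<odot>\<^bsub>M\<^esub> m"
proof -
  let ?N = "(\<lambda>a. a \<odot>\<^bsub>M\<^esub> m) ` carrier R"
  have "?N = carrier M"
  proof (rule nonzero_generates)
    show "x \<oplus>\<^bsub>M\<^esub> y \<in> ?N" if "x \<in> ?N" "y \<in> ?N" for x y
      using that smult_l_distr[OF _ _ m(1)] R.a_closed by (blast intro: sym)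
    show "b \<odot>\<^bsub>M\<^esub> x \<in> ?N" if "b \<in> carrier R" "x \<in> ?N" for b x
      using that smult_assoc[OF _ _ m(1)] R.m_closed by (blast intro: sym)
    show "\<zero>\<^bsub>M\<^esub> \<in> ?N" by (rule image_eqI[of _ _ "\<zero>"]) (auto simp: zero_smult m)
    show "m \<in> ?N" by (rule image_eqI[of _ _ "\<one>"]) (auto simp: one_smult m)
  qed (use m smult_closed in auto)
  then show ?thesis using n by auto
qed

lemma smult_induct:
  assumes a: "a \<in> carrier R" and m: "m \<in> carrier M" and zero: "P \<zero>\<^bsub>M\<^esub>"
    and basis: "\<And>b. b \<in> supp a \<Longrightarrow> P (b \<odot>\<^bsub>M\<^esub> m)"
    and add: "\<And>x y. x \<in> carrier M \<Longrightarrow> y \<in> carrier M \<Longrightarrow> P x \<Longrightarrow> P y \<Longrightarrow> P (x \<oplus>\<^bsub>M\<^esub> y)"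
  shows "P (a \<odot>\<^bsub>M\<^esub> m)"
  using a
proof (rule supp_induct)
  show "P (\<zero> \<odot>\<^bsub>M\<^esub> m)" using zero m by (simp add: zero_smult)
  show "P ((x \<oplus> y) \<odot>\<^bsub>M\<^esub> m)"
    if "x \<in> carrier R" "y \<in> carrier R" "P (x \<odot>\<^bsub>M\<^esub> m)" "P (y \<odot>\<^bsub>M\<^esub> m)" for x y
    using that m by (simp add: smult_l_distr add smult_closed)
qed (rule basis)

lemma smult_eq_zeroI:
  assumes "a \<in> carrier R" "m \<in> carrier M" "\<And>b. b \<in> supp a \<Longrightarrow> b \<odot>\<^bsub>M\<^esub> m = \<zero>\<^bsub>M\<^esub>"
  shows "a \<odot>\<^bsub>M\<^esub> m = \<zero>\<^bsub>M\<^esub>"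
  by (rule smult_induct[OF assms(1,2), where P = "\<lambda>n. n = \<zero>\<^bsub>M\<^esub>"]) (use assms(3) in auto)

lemma double_surj:
  assumes n: "n \<in> carrier M"
  shows "\<exists>h\<in>carrier M. n = h \<oplus>\<^bsub>M\<^esub> h"
proof -
  obtain m where m: "m \<in> carrier M" "m \<noteq> \<zero>\<^bsub>M\<^esub>"
    using minimal M.zero_closed unfolding minimal_semimodule_def by blast
  let ?N = "(\<lambda>h. h \<oplus>\<^bsub>M\<^esub> h) ` carrier M"
  have "?N = carrier M"
  proof (rule nonzero_generates)
    show "x \<oplus>\<^bsub>M\<^esub> y \<in> ?N" if xy: "x \<in> ?N" "y \<in> ?N" for x y
    proof -
      obtain h k where *: "h \<in> carrier M" "k \<in> carrier M" "x = h \<oplus>\<^bsub>M\<^esub> h" "y = k \<oplus>\<^bsub>M\<^esub> k"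
        using xy by blast
      then have "x \<oplus>\<^bsub>M\<^esub> y = (h \<oplus>\<^bsub>M\<^esub> k) \<oplus>\<^bsub>M\<^esub> (h \<oplus>\<^bsub>M\<^esub> k)"
        using add_add_swap[of h h k k] by simp
      then show ?thesis using * M.a_closed by blast
    qed
    show "b \<odot>\<^bsub>M\<^esub> x \<in> ?N" if "b \<in> carrier R" "x \<in> ?N" for b x
      using that smult_r_distr smult_closed by blast
    show "\<zero>\<^bsub>M\<^esub> \<in> ?N" by (rule image_eqI[of _ _ "\<zero>\<^bsub>M\<^esub>"]) auto
    show "m \<oplus>\<^bsub>M\<^esub> m \<in> ?N" using m by blast
    show "m \<oplus>\<^bsub>M\<^esub> m \<noteq> \<zero>\<^bsub>M\<^esub>" using zerosumfree m by blast
  qed auto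
  then show ?thesis using n by auto
qed

text \<open>Fix a non-zero \<open>m\<close>. Every non-zero element has some non-zero \<open>b m\<close>, with \<open>b\<close> in the basis, as a
  summand. Since \<open>b m\<close> is a double, it therefore contains some non-zero \<open>b' m\<close> twice. This
  relation on a finite set of basis elements is transitive and has no dead ends, so some \<open>b m = g\<close>
  contains itself twice, \<open>g = g + g + t\<close>. Then \<open>g + t\<close> is idempotent.\<close>

lemma exists_idempotent:
  "\<exists>e\<in>carrier M. e \<noteq> \<zero>\<^bsub>M\<^esub> \<and> e \<oplus>\<^bsub>M\<^esub> e = e"
proof -
  obtain m where m: "m \<in> carrier M" "m \<noteq> \<zero>\<^bsub>M\<^esub>"
    using minimal M.zero_closed unfolding minimal_semimodule_def by blast
  define G where "G = {b \<in> B. b \<odot>\<^bsub>M\<^esub> m \<noteq> \<zero>\<^bsub>M\<^esub>}"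
  define r where "r b b' \<longleftrightarrow> (\<exists>t\<in>carrier M. b \<odot>\<^bsub>M\<^esub> m = b' \<odot>\<^bsub>M\<^esub> m \<oplus>\<^bsub>M\<^esub> b' \<odot>\<^bsub>M\<^esub> m \<oplus>\<^bsub>M\<^esub> t)"
    for b b'
  have Gc: "b \<odot>\<^bsub>M\<^esub> m \<in> carrier M" if "b \<in> G" for b
    using that m by (simp add: G_def smult_closed basis_in_carrier)
  have below: "\<exists>b\<in>G. \<exists>t\<in>carrier M. n = b \<odot>\<^bsub>M\<^esub> m \<oplus>\<^bsub>M\<^esub> t"
    if n: "n \<in> carrier M" "n \<noteq> \<zero>\<^bsub>M\<^esub>" for n
  proof -
    obtain a where a: "a \<in> carrier R" "n = a \<odot>\<^bsub>M\<^esub> m" using cyclic[OF m n(1)] by blast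
    have "\<exists>b\<in>supp a. b \<odot>\<^bsub>M\<^esub> m \<noteq> \<zero>\<^bsub>M\<^esub>"
    proof (rule ccontr)
      assume "\<not> (\<exists>b\<in>supp a. b \<odot>\<^bsub>M\<^esub> m \<noteq> \<zero>\<^bsub>M\<^esub>)"
      then have "a \<odot>\<^bsub>M\<^esub> m = \<zero>\<^bsub>M\<^esub>"
        using smult_eq_zeroI[OF a(1) m(1)] by blast
      then show False using n a by simp
    qed
    then obtain b where b: "b \<in> supp a" "b \<odot>\<^bsub>M\<^esub> m \<noteq> \<zero>\<^bsub>M\<^esub>" by blast
    then obtain a' where a': "a' \<in> carrier R" "a = b \<oplus> a'" using supp_split[OF a(1)] by blast
    have "n = b \<odot>\<^bsub>M\<^esub> m \<oplus>\<^bsub>M\<^esub> a' \<odot>\<^bsub>M\<^esub> m"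
      using a a' b m supp_in_carrier by (simp add: smult_l_distr)
    moreover have "b \<in> G" using b supp_subset by (auto simp: G_def)
    ultimately show ?thesis using smult_closed[OF a'(1) m(1)] by blast
  qed
  have serial: "\<exists>b'\<in>G. r b b'" if b: "b \<in> G" for b
  proof -
    obtain h where h: "h \<in> carrier M" "b \<odot>\<^bsub>M\<^esub> m = h \<oplus>\<^bsub>M\<^esub> h"
      using double_surj[OF Gc[OF b]] by blast
    then have "h \<noteq> \<zero>\<^bsub>M\<^esub>" using b by (auto simp: G_def)
    then obtain b' t where b': "b' \<in> G" "t \<in> carrier M" "h = b' \<odot>\<^bsub>M\<^esub> m \<oplus>\<^bsub>M\<^esub> t"
      using below[OF h(1)] by blast
    have "b \<odot>\<^bsub>M\<^esub> m = b' \<odot>\<^bsub>M\<^esub> m \<oplus>\<^bsub>M\<^esub> b' \<odot>\<^bsub>M\<^esub> m \<oplus>\<^bsub>M\<^esub> (t \<oplus>\<^bsub>M\<^esub> t)"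
      unfolding h(2) b'(3) using b' Gc by (simp add: M.a_ac)
    then show ?thesis using b' unfolding r_def by blast
  qed
  have r_trans: "r b b''" if "b \<in> G" "b' \<in> G" "b'' \<in> G" and bb: "r b b'" "r b' b''" for b b' b''
  proof -
    obtain t t' where t: "t \<in> carrier M" "b \<odot>\<^bsub>M\<^esub> m = b' \<odot>\<^bsub>M\<^esub> m \<oplus>\<^bsub>M\<^esub> b' \<odot>\<^bsub>M\<^esub> m \<oplus>\<^bsub>M\<^esub> t"
      and t': "t' \<in> carrier M" "b' \<odot>\<^bsub>M\<^esub> m = b'' \<odot>\<^bsub>M\<^esub> m \<oplus>\<^bsub>M\<^esub> b'' \<odot>\<^bsub>M\<^esub> m \<oplus>\<^bsub>M\<^esub> t'"
      using bb unfolding r_def by blast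
    note c = Gc[OF \<open>b' \<in> G\<close>] Gc[OF \<open>b'' \<in> G\<close>]
    have "b \<odot>\<^bsub>M\<^esub> m = b' \<odot>\<^bsub>M\<^esub> m \<oplus>\<^bsub>M\<^esub> (b' \<odot>\<^bsub>M\<^esub> m \<oplus>\<^bsub>M\<^esub> t)"
      using t c by (simp add: M.a_assoc)
    also have "\<dots> = (b'' \<odot>\<^bsub>M\<^esub> m \<oplus>\<^bsub>M\<^esub> b'' \<odot>\<^bsub>M\<^esub> m \<oplus>\<^bsub>M\<^esub> t') \<oplus>\<^bsub>M\<^esub> (b' \<odot>\<^bsub>M\<^esub> m \<oplus>\<^bsub>M\<^esub> t)"
      by (simp only: t'(2)[symmetric])
    also have "\<dots> = b'' \<odot>\<^bsub>M\<^esub> m \<oplus>\<^bsub>M\<^esub> b'' \<odot>\<^bsub>M\<^esub> m \<oplus>\<^bsub>M\<^esub> (t' \<oplus>\<^bsub>M\<^esub> (b' \<odot>\<^bsub>M\<^esub> m \<oplus>\<^bsub>M\<^esub> t))"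
      using t t' c by (simp add: M.a_assoc)
    finally show ?thesis using t t' c unfolding r_def by blast
  qed
  have "finite G" "G \<noteq> {}"
    using finite_basis below[OF m] by (auto simp: G_def)
  then obtain b where b: "b \<in> G" and max: "\<forall>b'\<in>G. r b b' \<longrightarrow> r b' b"
    using finite_transp_maximal[of G r] r_trans by blast
  obtain b' where "b' \<in> G" "r b b'" using serial[OF b] by blast
  then have "r b b" using max r_trans b by blast
  then obtain t where t: "t \<in> carrier M" "b \<odot>\<^bsub>M\<^esub> m = b \<odot>\<^bsub>M\<^esub> m \<oplus>\<^bsub>M\<^esub> b \<odot>\<^bsub>M\<^esub> m \<oplus>\<^bsub>M\<^esub> t"
    unfolding r_def by blast
  define g where "g = b \<odot>\<^bsub>M\<^esub> m"
  have g: "g \<in> carrier M" "g \<noteq> \<zero>\<^bsub>M\<^esub>" "g \<oplus>\<^bsub>M\<^esub> g \<oplus>\<^bsub>M\<^esub> t = g"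
    using Gc[OF b] b t(2)[symmetric] unfolding g_def G_def by blast+
  have "(g \<oplus>\<^bsub>M\<^esub> t) \<oplus>\<^bsub>M\<^esub> (g \<oplus>\<^bsub>M\<^esub> t) = (g \<oplus>\<^bsub>M\<^esub> g \<oplus>\<^bsub>M\<^esub> t) \<oplus>\<^bsub>M\<^esub> t"
    using g(1) t(1) by (simp add: M.a_ac)
  also have "\<dots> = g \<oplus>\<^bsub>M\<^esub> t" by (simp only: g(3))
  finally show ?thesis
    using g t(1) zerosumfree[of g t] by (intro bexI[of _ "g \<oplus>\<^bsub>M\<^esub> t"]) auto
qed

lemma add_idem:
  assumes x: "x \<in> carrier M"
  shows "x \<oplus>\<^bsub>M\<^esub> x = x"
proof -
  obtain e where e: "e \<in> carrier M" "e \<noteq> \<zero>\<^bsub>M\<^esub>" "e \<oplus>\<^bsub>M\<^esub> e = e"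
    using exists_idempotent by blast
  let ?N = "{x \<in> carrier M. x \<oplus>\<^bsub>M\<^esub> x = x}"
  have "?N = carrier M"
  proof (rule nonzero_generates)
    show "x \<oplus>\<^bsub>M\<^esub> y \<in> ?N" if xy: "x \<in> ?N" "y \<in> ?N" for x y
    proof -
      have "x \<oplus>\<^bsub>M\<^esub> y \<oplus>\<^bsub>M\<^esub> (x \<oplus>\<^bsub>M\<^esub> y) = (x \<oplus>\<^bsub>M\<^esub> x) \<oplus>\<^bsub>M\<^esub> (y \<oplus>\<^bsub>M\<^esub> y)"
        by (rule add_add_swap) (use xy in auto)
      then show ?thesis using xy by simp
    qed
    show "b \<odot>\<^bsub>M\<^esub> x \<in> ?N" if "b \<in> carrier R" "x \<in> ?N" for b x
      using that smult_r_distr[of b x x] smult_closed[of b x] by simp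
  qed (use e in auto)
  then show ?thesis using x by blast
qed

text \<open>As addition is idempotent, \<open>M\<close> is a join semilattice under this order.\<close>

definition below (infix "\<sqsubseteq>" 50) where "x \<sqsubseteq> y \<longleftrightarrow> x \<oplus>\<^bsub>M\<^esub> y = y"

lemma below_antisym: "x \<in> carrier M \<Longrightarrow> y \<in> carrier M \<Longrightarrow> x \<sqsubseteq> y \<Longrightarrow> y \<sqsubseteq> x \<Longrightarrow> x = y"
  unfolding below_def using M.a_comm by metis

lemma below_trans:
  "x \<in> carrier M \<Longrightarrow> y \<in> carrier M \<Longrightarrow> z \<in> carrier M \<Longrightarrow> x \<sqsubseteq> y \<Longrightarrow> y \<sqsubseteq> z \<Longrightarrow> x \<sqsubseteq> z"
  unfolding below_def by (metis M.a_assoc)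

lemma zero_below: "x \<in> carrier M \<Longrightarrow> \<zero>\<^bsub>M\<^esub> \<sqsubseteq> x"
  by (simp add: below_def)

lemma below_zero: "x \<in> carrier M \<Longrightarrow> x \<sqsubseteq> \<zero>\<^bsub>M\<^esub> \<Longrightarrow> x = \<zero>\<^bsub>M\<^esub>"
  by (simp add: below_def)

lemma below_add: "x \<in> carrier M \<Longrightarrow> y \<in> carrier M \<Longrightarrow> x \<sqsubseteq> x \<oplus>\<^bsub>M\<^esub> y"
  unfolding below_def by (metis M.a_assoc add_idem)

lemma add_below:
  "x \<in> carrier M \<Longrightarrow> y \<in> carrier M \<Longrightarrow> z \<in> carrier M \<Longrightarrow> x \<sqsubseteq> z \<Longrightarrow> y \<sqsubseteq> z \<Longrightarrow> x \<oplus>\<^bsub>M\<^esub> y \<sqsubseteq> z"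
  unfolding below_def by (metis M.a_assoc)

lemma smult_mono:
  "a \<in> carrier R \<Longrightarrow> x \<in> carrier M \<Longrightarrow> y \<in> carrier M \<Longrightarrow> x \<sqsubseteq> y \<Longrightarrow> a \<odot>\<^bsub>M\<^esub> x \<sqsubseteq> a \<odot>\<^bsub>M\<^esub> y"
  unfolding below_def by (metis smult_r_distr)

lemma supp_smult_below:
  assumes "a \<in> carrier R" "b \<in> supp a" "n \<in> carrier M"
  shows "b \<odot>\<^bsub>M\<^esub> n \<sqsubseteq> a \<odot>\<^bsub>M\<^esub> n"
proof -
  obtain a' where "a' \<in> carrier R" "a = b \<oplus> a'" using supp_split assms by blast
  then show ?thesis
    using assms supp_in_carrier below_add smult_closed by (simp add: smult_l_distr)
qed

text \<open>By idempotency the value of \<open>a n\<close> is the join of the \<open>b n\<close> for \<open>b\<close> in the support of \<open>a\<close>, so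
  multiplicities do not matter.\<close>

lemma smult_below_smult:
  assumes a: "a \<in> carrier R" and a': "a' \<in> carrier R" and n: "n \<in> carrier M"
    and dom: "\<And>b. b \<in> supp a \<Longrightarrow>
      b \<odot>\<^bsub>M\<^esub> n = \<zero>\<^bsub>M\<^esub> \<or> (\<exists>b'\<in>supp a'. b \<odot>\<^bsub>M\<^esub> n = b' \<odot>\<^bsub>M\<^esub> n)"
  shows "a \<odot>\<^bsub>M\<^esub> n \<sqsubseteq> a' \<odot>\<^bsub>M\<^esub> n"
  using a n
proof (rule smult_induct)
  have c: "a' \<odot>\<^bsub>M\<^esub> n \<in> carrier M" using a' n by (rule smult_closed)
  show "\<zero>\<^bsub>M\<^esub> \<sqsubseteq> a' \<odot>\<^bsub>M\<^esub> n" by (rule zero_below[OF c])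
  show "b \<odot>\<^bsub>M\<^esub> n \<sqsubseteq> a' \<odot>\<^bsub>M\<^esub> n" if "b \<in> supp a" for b
    using dom[OF that] supp_smult_below[OF a' _ n] zero_below[OF c] by metis
  show "x \<oplus>\<^bsub>M\<^esub> y \<sqsubseteq> a' \<odot>\<^bsub>M\<^esub> n"
    if "x \<in> carrier M" "y \<in> carrier M" "x \<sqsubseteq> a' \<odot>\<^bsub>M\<^esub> n" "y \<sqsubseteq> a' \<odot>\<^bsub>M\<^esub> n" for x y
    using that c by (intro add_below)
qed

text \<open>Since \<open>M\<close> is generated by \<open>m\<close>, each of its elements is a join of elements \<open>b m\<close> with \<open>b\<close> in the
  basis, and the join of all of these is the largest element.\<close>

lemma exists_top: "\<exists>t\<in>carrier M. t \<noteq> \<zero>\<^bsub>M\<^esub> \<and> (\<forall>n\<in>carrier M. n \<sqsubseteq> t)"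
proof -
  obtain m where m: "m \<in> carrier M" "m \<noteq> \<zero>\<^bsub>M\<^esub>"
    using minimal M.zero_closed unfolding minimal_semimodule_def by blast
  let ?t = "basis_sum B \<odot>\<^bsub>M\<^esub> m"
  have t: "?t \<in> carrier M" using m by (simp add: smult_closed)
  have top: "n \<sqsubseteq> ?t" if "n \<in> carrier M" for n
  proof -
    obtain a where "a \<in> carrier R" "n = a \<odot>\<^bsub>M\<^esub> m" using cyclic[OF m \<open>n \<in> carrier M\<close>] by blast
    moreover have "supp a \<subseteq> supp (basis_sum B)" using supp_subset by (simp add: supp_basis_sum)
    ultimately show ?thesis using m(1) by (blast intro: smult_below_smult basis_sum_closed)
  qed
  have "?t \<noteq> \<zero>\<^bsub>M\<^esub>" using top[OF m(1)] below_zero m by metis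
  then show ?thesis using t top by blast
qed

text \<open>Take \<open>w\<close> maximal for \<open>\<preceq>\<^sub>J\<close> among the basis elements that do not annihilate \<open>M\<close>. The elements
  killed by everything above \<open>w\<close> form a proper subsemimodule, which is zero by minimality. So some
  \<open>x\<close> above \<open>w\<close> does not kill \<open>t\<close>, and maximality puts it in the two-sided cell of \<open>w\<close>.\<close>

lemma exists_apex:
  assumes t: "t \<in> carrier M" "t \<noteq> \<zero>\<^bsub>M\<^esub>"
  shows "\<exists>x\<in>B. x \<odot>\<^bsub>M\<^esub> t \<noteq> \<zero>\<^bsub>M\<^esub> \<and>
    (\<forall>z. x \<preceq>\<^sub>J z \<longrightarrow> \<not> z \<preceq>\<^sub>J x \<longrightarrow> (\<forall>n\<in>carrier M. z \<odot>\<^bsub>M\<^esub> n = \<zero>\<^bsub>M\<^esub>))"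
proof -
  define A where "A = {b \<in> B. \<exists>n\<in>carrier M. b \<odot>\<^bsub>M\<^esub> n \<noteq> \<zero>\<^bsub>M\<^esub>}"
  have "A \<noteq> {}"
  proof
    assume "A = {}"
    then have "\<one> \<odot>\<^bsub>M\<^esub> t = \<zero>\<^bsub>M\<^esub>"
      using smult_eq_zeroI[OF R.one_closed t(1)] t(1) supp_subset unfolding A_def by blast
    then show False using t one_smult by simp
  qed
  moreover have "finite A" using finite_basis by (simp add: A_def)
  ultimately obtain w where w: "w \<in> A" and max: "\<forall>z\<in>A. w \<preceq>\<^sub>J z \<longrightarrow> z \<preceq>\<^sub>J w"
    using finite_transp_maximal[of A le_J] le_J_trans by blast
  have wB: "w \<in> B" using w by (simp add: A_def)
  let ?N = "{n \<in> carrier M. \<forall>b. w \<preceq>\<^sub>J b \<longrightarrow> b \<odot>\<^bsub>M\<^esub> n = \<zero>\<^bsub>M\<^esub>}"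
  have bR: "b \<in> carrier R" if "w \<preceq>\<^sub>J b" for b
    using that le_J_basis basis_in_carrier by blast
  have "?N = {\<zero>\<^bsub>M\<^esub>} \<or> ?N = carrier M"
  proof (rule subsemimodule_trivial)
    show "x \<oplus>\<^bsub>M\<^esub> y \<in> ?N" if "x \<in> ?N" "y \<in> ?N" for x y
      using that bR by (simp add: smult_r_distr)
    show "a \<odot>\<^bsub>M\<^esub> n \<in> ?N" if a: "a \<in> carrier R" and n: "n \<in> ?N" for a n
    proof -
      have "b \<odot>\<^bsub>M\<^esub> (a \<odot>\<^bsub>M\<^esub> n) = \<zero>\<^bsub>M\<^esub>" if b: "w \<preceq>\<^sub>J b" for b
      proof -
        have "(b \<otimes> a) \<odot>\<^bsub>M\<^esub> n = \<zero>\<^bsub>M\<^esub>"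
        proof (rule smult_eq_zeroI)
          fix b' assume "b' \<in> supp (b \<otimes> a)"
          then have "b \<preceq>\<^sub>R b'" using b a le_J_basis by (blast intro: le_RI)
          then have "w \<preceq>\<^sub>J b'" using b le_R_imp_le_J le_J_trans by blast
          then show "b' \<odot>\<^bsub>M\<^esub> n = \<zero>\<^bsub>M\<^esub>" using n by blast
        qed (use a n b bR in auto)
        then show ?thesis using a n b bR by (simp add: smult_assoc)
      qed
      then show ?thesis using a n smult_closed by blast
    qed
  qed (use bR smult_zero in auto)
  moreover have "?N \<noteq> carrier M"
    using w le_J_refl[OF wB] by (auto simp: A_def)
  ultimately have "t \<notin> ?N" using t by blast
  then obtain x where x: "w \<preceq>\<^sub>J x" "x \<odot>\<^bsub>M\<^esub> t \<noteq> \<zero>\<^bsub>M\<^esub>" using t by blast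
  have "x \<in> B" using x le_J_basis by blast
  moreover have "z \<odot>\<^bsub>M\<^esub> n = \<zero>\<^bsub>M\<^esub>" if z: "x \<preceq>\<^sub>J z" "\<not> z \<preceq>\<^sub>J x" "n \<in> carrier M" for z n
  proof (rule ccontr)
    assume "z \<odot>\<^bsub>M\<^esub> n \<noteq> \<zero>\<^bsub>M\<^esub>"
    then have "z \<in> A" using z le_J_basis by (auto simp: A_def)
    then have "z \<preceq>\<^sub>J w" using max z x le_J_trans by blast
    then show False using z x le_J_trans by blast
  qed
  ultimately show ?thesis using x(2) by blast
qed

text \<open>If \<open>y'\<close> occurs in \<open>y c\<close>, then \<open>y' t\<close> is below \<open>y (c t)\<close>, and \<open>c t\<close> is below \<open>t\<close>. Taking the
  largest element for \<open>t\<close> is what makes right equivalent elements act alike on it.\<close>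

lemma le_R_smult_top:
  assumes t: "t \<in> carrier M" "\<forall>n\<in>carrier M. n \<sqsubseteq> t" and le: "y \<preceq>\<^sub>R y'"
  shows "y' \<odot>\<^bsub>M\<^esub> t \<sqsubseteq> y \<odot>\<^bsub>M\<^esub> t"
proof -
  obtain c where c: "y \<in> B" "c \<in> carrier R" "y' \<in> supp (y \<otimes> c)" using le by (auto simp: le_R_iff)
  have y: "y \<in> carrier R" "y' \<in> carrier R"
    using c supp_in_carrier basis_in_carrier by auto
  have "y' \<odot>\<^bsub>M\<^esub> t \<sqsubseteq> (y \<otimes> c) \<odot>\<^bsub>M\<^esub> t"
    using c y t by (intro supp_smult_below) auto
  also have "(y \<otimes> c) \<odot>\<^bsub>M\<^esub> t = y \<odot>\<^bsub>M\<^esub> (c \<odot>\<^bsub>M\<^esub> t)"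
    using c y t by (simp add: smult_assoc)
  finally have 1: "y' \<odot>\<^bsub>M\<^esub> t \<sqsubseteq> y \<odot>\<^bsub>M\<^esub> (c \<odot>\<^bsub>M\<^esub> t)" .
  have "y \<odot>\<^bsub>M\<^esub> (c \<odot>\<^bsub>M\<^esub> t) \<sqsubseteq> y \<odot>\<^bsub>M\<^esub> t"
    using c y t by (intro smult_mono) (auto simp: smult_closed)
  with 1 show ?thesis
    using c y t by (intro below_trans[OF _ _ _ 1]) (auto simp: smult_closed)
qed

text \<open>The map \<open>\<phi>\<close> sends a set of H-cells to the join of the \<open>y t\<close> over the elements \<open>y\<close> of these
  cells. For compatibility with the action, compare the basis elements occurring in \<open>a y\<close> with those
  in the H-cells of the image: outside \<open>L\<close> they kill \<open>t\<close>, by stability and maximality of the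
  two-sided cell, and inside \<open>L\<close> elements of one H-cell have the same value at \<open>t\<close>.\<close>

lemma isomorphic_reduced_cell_quotient:
  "\<exists>L\<in>left_cells R B. \<exists>E. semimodule_congruence R (reduced_cell_semimodule R B L) E \<and>
     semimodule_isomorphic R M (quotient_semimodule (reduced_cell_semimodule R B L) E)"
proof -
  obtain t where t: "t \<in> carrier M" "t \<noteq> \<zero>\<^bsub>M\<^esub>" and top: "\<forall>n\<in>carrier M. n \<sqsubseteq> t"
    using exists_top by blast
  obtain x where x: "x \<in> B" "x \<odot>\<^bsub>M\<^esub> t \<noteq> \<zero>\<^bsub>M\<^esub>"
    and apex: "\<And>z n. x \<preceq>\<^sub>J z \<Longrightarrow> \<not> z \<preceq>\<^sub>J x \<Longrightarrow> n \<in> carrier M \<Longrightarrow> z \<odot>\<^bsub>M\<^esub> n = \<zero>\<^bsub>M\<^esub>"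
    using exists_apex[OF t] by blast
  define L where "L = {z. x \<preceq>\<^sub>L z \<and> z \<preceq>\<^sub>L x}"
  have L: "L \<in> left_cells R B" unfolding left_cells_iff L_def by (rule bexI[OF refl x(1)])
  have xL: "x \<in> L" using x le_L_refl by (simp add: L_def)
  let ?C = "reduced_cell_semimodule R B L"
  note simps = reduced_cell_semimodule_carrier reduced_cell_semimodule_zero reduced_cell_semimodule_add
  interpret C: semimodule R ?C by (rule semimodule_reduced_cell_semimodule[OF L])
  have LB: "L \<subseteq> B" by (rule left_cell_subset[OF L])
  have UL: "\<Union>X \<subseteq> L" if "X \<in> carrier ?C" for X
    using that unfolding simps H_cells_in_def by blast
  have suppU: "supp (basis_sum (\<Union>X)) = \<Union>X" if "X \<in> carrier ?C" for X
    using UL[OF that] LB by (intro supp_basis_sum) blast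
  have zero_outside: "z \<odot>\<^bsub>M\<^esub> t = \<zero>\<^bsub>M\<^esub>" if "y \<in> L" "y \<preceq>\<^sub>L z" "z \<notin> L" for y z
  proof -
    have "x \<preceq>\<^sub>L z" using that le_L_trans unfolding L_def by blast
    moreover have "\<not> z \<preceq>\<^sub>J x"
      using le_L_stable[OF \<open>x \<preceq>\<^sub>L z\<close>] \<open>x \<preceq>\<^sub>L z\<close> that(3) by (auto simp: L_def)
    ultimately show ?thesis using apex le_L_imp_le_J t(1) by blast
  qed
  have H_eq: "y \<odot>\<^bsub>M\<^esub> t = y' \<odot>\<^bsub>M\<^esub> t" if "y' \<in> H_class y" for y y'
  proof -
    have "y \<preceq>\<^sub>R y'" "y' \<preceq>\<^sub>R y" using that by (auto simp: H_class_def)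
    moreover have "y \<in> carrier R" "y' \<in> carrier R"
      using calculation le_R_basis basis_in_carrier by auto
    ultimately show ?thesis
      using le_R_smult_top[OF t(1) top] t(1) by (intro below_antisym smult_closed) auto
  qed
  define \<phi> where "\<phi> X = basis_sum (\<Union>X) \<odot>\<^bsub>M\<^esub> t" for X
  have phi_closed: "\<phi> X \<in> carrier M" for X
    using t(1) by (simp add: \<phi>_def smult_closed)
  have phi_zero: "\<phi> \<zero>\<^bsub>?C\<^esub> = \<zero>\<^bsub>M\<^esub>"
  proof (rule below_zero[OF phi_closed])
    have "\<phi> \<zero>\<^bsub>?C\<^esub> \<sqsubseteq> \<zero> \<odot>\<^bsub>M\<^esub> t"
      unfolding \<phi>_def using t(1) suppU[OF C.zero_closed]
      by (intro smult_below_smult) (auto simp: simps)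
    then show "\<phi> \<zero>\<^bsub>?C\<^esub> \<sqsubseteq> \<zero>\<^bsub>M\<^esub>" using t(1) by (simp add: zero_smult)
  qed
  have phi_add: "\<phi> (X \<oplus>\<^bsub>?C\<^esub> Y) = \<phi> X \<oplus>\<^bsub>M\<^esub> \<phi> Y" if XY: "X \<in> carrier ?C" "Y \<in> carrier ?C" for X Y
  proof -
    let ?b = "basis_sum (\<Union>X) \<oplus> basis_sum (\<Union>Y)" and ?u = "basis_sum (\<Union>(X \<oplus>\<^bsub>?C\<^esub> Y))"
    have b: "?b \<in> carrier R" by simp
    have eq: "supp ?u = supp ?b"
      using suppU[OF C.M.a_closed[OF XY]] suppU[OF XY(1)] suppU[OF XY(2)]
      by (simp add: supp_add simps Union_Un_distrib)
    have "?u \<odot>\<^bsub>M\<^esub> t = ?b \<odot>\<^bsub>M\<^esub> t"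
      by (intro below_antisym smult_below_smult smult_closed b basis_sum_closed t(1))
        (use eq in blast)+
    then show ?thesis using t(1) by (simp add: \<phi>_def smult_l_distr)
  qed
  have phi_smult: "\<phi> (a \<odot>\<^bsub>?C\<^esub> X) = a \<odot>\<^bsub>M\<^esub> \<phi> X" if a: "a \<in> carrier R" and X: "X \<in> carrier ?C" for a X
  proof -
    let ?b = "a \<otimes> basis_sum (\<Union>X)" and ?u = "basis_sum (\<Union>(a \<odot>\<^bsub>?C\<^esub> X))"
    have b: "?b \<in> carrier R" using a by simp
    have supp_b: "supp ?b = (\<Union>y\<in>\<Union>X. supp (a \<otimes> y))"
      using supp_mult_left[OF a, of "basis_sum (\<Union>X)"] suppU[OF X] by simp
    have supp_u: "supp ?u = \<Union>(a \<odot>\<^bsub>?C\<^esub> X)" by (rule suppU[OF C.smult_closed[OF a X]])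
    have XH: "X \<subseteq> H_cells_in R B L" using X by (simp add: simps)
    have "?u \<odot>\<^bsub>M\<^esub> t = ?b \<odot>\<^bsub>M\<^esub> t"
    proof (intro below_antisym smult_below_smult smult_closed b basis_sum_closed t(1))
      fix z assume "z \<in> supp ?u"
      then obtain K where K: "K \<in> a \<odot>\<^bsub>?C\<^esub> X" "z \<in> K" unfolding supp_u by blast
      then obtain y z' where y: "y \<in> \<Union>X" "z' \<in> K" "z' \<in> supp (a \<otimes> y)"
        and KH: "K \<in> H_cells_in R B L"
        using reduced_smult_mem_iff[OF L XH a] by blast
      have "z \<in> H_class z'" using K(2) y(2) KH H_class_eq unfolding H_cells_in_eq[OF L] by blast
      then have "z \<odot>\<^bsub>M\<^esub> t = z' \<odot>\<^bsub>M\<^esub> t" using H_eq by metis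
      then show "z \<odot>\<^bsub>M\<^esub> t = \<zero>\<^bsub>M\<^esub> \<or> (\<exists>b'\<in>supp ?b. z \<odot>\<^bsub>M\<^esub> t = b' \<odot>\<^bsub>M\<^esub> t)"
        using y unfolding supp_b by blast
    next
      fix z assume "z \<in> supp ?b"
      then obtain y where y: "y \<in> \<Union>X" "z \<in> supp (a \<otimes> y)" unfolding supp_b by blast
      have yL: "y \<in> L" and yB: "y \<in> B" using UL[OF X] y(1) LB by auto
      show "z \<odot>\<^bsub>M\<^esub> t = \<zero>\<^bsub>M\<^esub> \<or> (\<exists>b'\<in>supp ?u. z \<odot>\<^bsub>M\<^esub> t = b' \<odot>\<^bsub>M\<^esub> t)"
      proof (cases "z \<in> L")
        case True
        then have "z \<in> H_class z" using LB H_class_self by blast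
        then have "H_class z \<in> a \<odot>\<^bsub>?C\<^esub> X"
          using H_class_mem_reduced_smult_iff[OF L XH a True] y by blast
        then show ?thesis unfolding supp_u using \<open>z \<in> H_class z\<close> by blast
      next
        case False
        then show ?thesis using zero_outside[OF yL le_LI[OF yB a y(2)]] by blast
      qed
    qed
    then show ?thesis using a t(1) by (simp add: \<phi>_def smult_assoc)
  qed
  have "\<phi> ` carrier ?C = carrier M"
  proof (rule nonzero_generates)
    let ?X = "{H_class x}"
    have X: "?X \<in> carrier ?C" using xL by (simp add: simps H_cells_in_eq[OF L])
    then show "\<phi> ?X \<in> \<phi> ` carrier ?C" by (rule imageI)
    have "x \<in> supp (basis_sum (\<Union>?X))" using suppU[OF X] H_class_self[OF x(1)] by simp
    then have "x \<odot>\<^bsub>M\<^esub> t \<sqsubseteq> \<phi> ?X" unfolding \<phi>_def using t(1) by (intro supp_smult_below) auto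
    then show "\<phi> ?X \<noteq> \<zero>\<^bsub>M\<^esub>"
      using below_zero x smult_closed[OF basis_in_carrier[OF x(1)] t(1)] by metis
    show "\<zero>\<^bsub>M\<^esub> \<in> \<phi> ` carrier ?C" using phi_zero C.zero_closed by (metis imageI)
    show "m \<oplus>\<^bsub>M\<^esub> n \<in> \<phi> ` carrier ?C" if mn: "m \<in> \<phi> ` carrier ?C" "n \<in> \<phi> ` carrier ?C" for m n
    proof -
      obtain X Y where "X \<in> carrier ?C" "Y \<in> carrier ?C" "m = \<phi> X" "n = \<phi> Y" using mn by blast
      then show ?thesis using phi_add[of X Y] C.M.a_closed[of X Y] by (metis imageI)
    qed
    show "a \<odot>\<^bsub>M\<^esub> m \<in> \<phi> ` carrier ?C" if a: "a \<in> carrier R" and m: "m \<in> \<phi> ` carrier ?C" for a m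
    proof -
      obtain X where "X \<in> carrier ?C" "m = \<phi> X" using m by blast
      then show ?thesis using phi_smult[OF a, of X] C.smult_closed[OF a, of X] by (metis imageI)
    qed
  qed (use phi_closed in blast)
  then show ?thesis
    using C.surjective_hom_quotient_isomorphic[of \<phi> M, OF _ phi_zero phi_add phi_smult] L by blast
qed

end


section \<open>The classification of minimal proper semimodules\<close>

theorem theorem9p9:
  fixes R :: "('r, 'x) ring_scheme" and B :: "'r set"
  assumes "fg_nat_semiring R B"
    and "\<forall>J\<in>two_sided_cells R B. idempotent_cell R B J"
  shows "(\<forall>M :: ('r, 'm, 'y) module_scheme.
            minimal_semimodule R M \<and> proper_semimodule R M \<longrightarrow>
            (\<exists>L\<in>left_cells R B. \<exists>E.
               semimodule_congruence R (reduced_cell_semimodule R B L) E \<and>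
               semimodule_isomorphic R M
                 (quotient_semimodule (reduced_cell_semimodule R B L) E))) \<and>
         (\<forall>L\<in>left_cells R B. \<forall>E.
            semimodule_congruence R (reduced_cell_semimodule R B L) E \<longrightarrow>
            (let Q = quotient_semimodule (reduced_cell_semimodule R B L) E in
             carrier Q \<noteq> {\<zero>\<^bsub>Q\<^esub>} \<longrightarrow> minimal_semimodule R Q))"
proof (intro conjI allI impI ballI)
  fix M :: "('r, 'm, 'y) module_scheme"
  assume M: "minimal_semimodule R M \<and> proper_semimodule R M"
  then interpret minimal_proper_semimodule R M B
    using assms(1)
    by (intro minimal_proper_semimodule.intro minimal_proper_semimodule_axioms.intro)
      (auto simp: minimal_semimodule_def)
  show "\<exists>L\<in>left_cells R B. \<exists>E.
      semimodule_congruence R (reduced_cell_semimodule R B L) E \<and>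
      semimodule_isomorphic R M (quotient_semimodule (reduced_cell_semimodule R B L) E)"
    by (rule isomorphic_reduced_cell_quotient)
next
  fix L E
  assume L: "L \<in> left_cells R B" and E: "semimodule_congruence R (reduced_cell_semimodule R B L) E"
  interpret fg_nat_semiring R B by (rule assms(1))
  interpret C: semimodule R "reduced_cell_semimodule R B L"
    by (rule semimodule_reduced_cell_semimodule[OF L])
  show "let Q = quotient_semimodule (reduced_cell_semimodule R B L) E in
      carrier Q \<noteq> {\<zero>\<^bsub>Q\<^esub>} \<longrightarrow> minimal_semimodule R Q"
    unfolding Let_def
    using C.minimal_semimodule_quotient[OF minimal_reduced_cell_semimodule[OF assms(2) L] E] by blast
qed

end
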